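(* Let $0\le a\in L^\infty(\mathbb T)$. (a) Let $s>0$. If $T_sv=\lambda v$ for some $0\ne v\in H^2(\mathbb T)$, then $$\Re\lambda=\frac{\|v'\|_2^2}{\|v\|_2^2},\qquad \Im\lambda=s\,\frac{\int_{\mathbb T}a|v|^2}{\|v\|_2^2}.$$ If $0<r\le\pi$, $\Theta_a(r)>0$, and $2C_Pr^2\Re\lambda\le1$, then $$\Im\lambda\ge\frac{s\,\Theta_a(r)}{2C_P}.$$ Consequently, if $L$ is a critical gauge and there exist $c>0$, $r_{\mathrm{mass}}\in(0,\pi]$ with $\Theta_a(r)\ge cL(1/r)^{-1}$ for $0<r\le r_{\mathrm{mass}}$, then there are $c_0,s_0>0$ such that $$\lambda\in\operatorname{spec}(T_s),\ \Re\lambda\le s,\ s\ge s_0\ \Longrightarrow\ \Im\lambda\ge c_0\frac{s}{L(s)}.$$ (b) Let $s_j>\frac12\|a\|_\infty$ and suppose $0\ne u\in H^2(\mathbb T)$ and $z\in\mathbb C$ solve $-u''+(s_j^2+za+z^2)u=0$. Then $$\Re z=-\frac12\frac{\int_{\mathbb T}a|u|^2}{\|u\|_2^2},\qquad (\Im z)^2=s_j^2+\frac{\|u'\|_2^2}{\|u\|_2^2}-\frac14\left(\frac{\int_{\mathbb T}a|u|^2}{\|u\|_2^2}\right)^2.$$ In particular $-\frac12\|a\|_\infty\le\Re z\le0$, and for every $c>0$, $$\frac{\int_{\{a\ge c\}}|u|^2}{\|u\|_2^2}\le\frac{2(-\Re z)}{c}.$$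
   Context: $\mathbb T=\mathbb R/2\pi\mathbb Z$; $T_s=-\partial_x^2+isa(x)$ on $L^2(\mathbb T)$ with domain $H^2(\mathbb T)$. $\Theta_a(r)=\inf_{x\in\mathbb T}\frac1{2r}\int_{x-r}^{x+r}a(y)\,dy$, $0<r\le\pi$ (torus arcs). $s_j=\sqrt{\lambda_j}$, where $0=\lambda_0<\lambda_1\le\cdots$ are the eigenvalues of $-\Delta_Y$ on a compact connected Riemannian manifold $Y$ without boundary, $\dim Y\ge1$. $C_P$ is a fixed universal constant such that, for all such $a$, every $0<r\le\pi$ with $\Theta_a(r)>0$ and every $v\in H^1(\mathbb T)$, $$\|v\|_2^2\le C_P\Bigl(\Theta_a(r)^{-1}\int_{\mathbb T}a|v|^2+r^2\|v'\|_2^2\Bigr)$$ (such a constant exists). A gauge $L:[S_0,\infty)\to[1,\infty)$, $S_0\ge1$, is critical if $L(S)=\ell(\log(eS))$ where $\ell:[1,\infty)\to[1,\infty)$ is nondecreasing and unbounded and there are $u_0\ge1$, $C_\ell\ge1$ with $\ell(2u)\le C_\ell\,\ell(u)$ for $u\ge u_0$; $L$ is extended constantly below $S_0$. *)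

theory Defs
  imports "HOL-Analysis.Analysis" "HOL-Probability.Essential_Supremum"
begin

section \<open>Function spaces on the circle\<close>

text \<open>A function on the circle is a \<open>2\<pi>\<close>-periodic, Lebesgue measurable function on the line.
  Elements of the Lebesgue and Sobolev spaces are given by representatives, and \<open>torus_eq\<close> is
  equality of the classes.\<close>

definition torus_fun :: "(real \<Rightarrow> 'a::topological_space) \<Rightarrow> bool" where
  "torus_fun f \<longleftrightarrow> f \<in> borel_measurable lebesgue \<and> (\<forall>x. f (x + 2 * pi) = f x)"

definition torus_eq :: "(real \<Rightarrow> 'a) \<Rightarrow> (real \<Rightarrow> 'a) \<Rightarrow> bool" where
  "torus_eq f g \<longleftrightarrow> (AE x in lebesgue. f x = g x)"

definition torus_int :: "(real \<Rightarrow> 'a::{banach, second_countable_topology}) \<Rightarrow> 'a" where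
  "torus_int f = (LINT x:{0..2*pi}|lebesgue. f x)"

definition torus_Linf :: "(real \<Rightarrow> real) \<Rightarrow> bool" where
  "torus_Linf a \<longleftrightarrow> torus_fun a \<and> esssup lebesgue (\<lambda>x. ereal \<bar>a x\<bar>) < \<infinity>"

definition Linf_norm :: "(real \<Rightarrow> real) \<Rightarrow> real" where
  "Linf_norm a = real_of_ereal (esssup lebesgue (\<lambda>x. ereal \<bar>a x\<bar>))"

definition torus_L2 :: "(real \<Rightarrow> complex) \<Rightarrow> bool" where
  "torus_L2 f \<longleftrightarrow> torus_fun f \<and> set_integrable lebesgue {0..2*pi} (\<lambda>x. (cmod (f x))\<^sup>2)"

definition L2_norm :: "(real \<Rightarrow> complex) \<Rightarrow> real" where
  "L2_norm f = sqrt (torus_int (\<lambda>x. (cmod (f x))\<^sup>2))"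

text \<open>\<open>D n\<close> is the \<open>n\<close>-th derivative of the test function.\<close>

definition torus_smooth :: "(real \<Rightarrow> complex) \<Rightarrow> bool" where
  "torus_smooth \<phi> \<longleftrightarrow> (\<forall>x. \<phi> (x + 2 * pi) = \<phi> x) \<and>
     (\<exists>D :: nat \<Rightarrow> real \<Rightarrow> complex. D 0 = \<phi> \<and>
        (\<forall>n x. (D n has_vector_derivative D (Suc n) x) (at x)))"

definition is_weak_deriv :: "(real \<Rightarrow> complex) \<Rightarrow> (real \<Rightarrow> complex) \<Rightarrow> bool" where
  "is_weak_deriv v w \<longleftrightarrow> (\<forall>\<phi>. torus_smooth \<phi> \<longrightarrow>
     torus_int (\<lambda>x. v x * vector_derivative \<phi> (at x)) = - torus_int (\<lambda>x. w x * \<phi> x))"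

definition torus_H1 :: "(real \<Rightarrow> complex) \<Rightarrow> bool" where
  "torus_H1 v \<longleftrightarrow> torus_L2 v \<and> (\<exists>w. torus_L2 w \<and> is_weak_deriv v w)"

text \<open>The weak derivative is unique up to \<open>torus_eq\<close>; \<open>wderiv v\<close> is a representative of it,
  meaningful for \<open>v\<close> in \<open>H\<^sup>1\<close>.\<close>

definition wderiv :: "(real \<Rightarrow> complex) \<Rightarrow> real \<Rightarrow> complex" where
  "wderiv v = (SOME w. torus_L2 w \<and> is_weak_deriv v w)"

definition torus_H2 :: "(real \<Rightarrow> complex) \<Rightarrow> bool" where
  "torus_H2 v \<longleftrightarrow> torus_H1 v \<and> torus_H1 (wderiv v)"


section \<open>The operator and its spectrum\<close>

definition T_op :: "(real \<Rightarrow> real) \<Rightarrow> real \<Rightarrow> (real \<Rightarrow> complex) \<Rightarrow> real \<Rightarrow> complex" where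
  "T_op a s v = (\<lambda>x. - wderiv (wderiv v) x + \<i> * of_real s * of_real (a x) * v x)"

text \<open>Resolvent set and spectrum in \<open>L\<^sup>2\<close> of an unbounded operator \<open>A\<close> with domain \<open>D\<close>:
  \<open>A - \<mu>\<close> is a bijection from the domain onto \<open>L\<^sup>2\<close> (modulo null sets), with bounded inverse.\<close>

definition L2_resolvent_set ::
  "((real \<Rightarrow> complex) \<Rightarrow> bool) \<Rightarrow> ((real \<Rightarrow> complex) \<Rightarrow> real \<Rightarrow> complex) \<Rightarrow> complex set" where
  "L2_resolvent_set D A = {\<mu>.
     (\<forall>f. torus_L2 f \<longrightarrow> (\<exists>v. D v \<and> torus_eq (\<lambda>x. A v x - \<mu> * v x) f \<and>
        (\<forall>w. D w \<and> torus_eq (\<lambda>x. A w x - \<mu> * w x) f \<longrightarrow> torus_eq w v))) \<and>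
     (\<exists>C. \<forall>v. D v \<longrightarrow> L2_norm v \<le> C * L2_norm (\<lambda>x. A v x - \<mu> * v x))}"

definition L2_spectrum ::
  "((real \<Rightarrow> complex) \<Rightarrow> bool) \<Rightarrow> ((real \<Rightarrow> complex) \<Rightarrow> real \<Rightarrow> complex) \<Rightarrow> complex set" where
  "L2_spectrum D A = - L2_resolvent_set D A"


section \<open>Averages, the Poincare constant, gauges\<close>

definition Theta :: "(real \<Rightarrow> real) \<Rightarrow> real \<Rightarrow> real" where
  "Theta a r = (INF x. 1 / (2 * r) * (LINT y:{x - r..x + r}|lebesgue. a y))"

definition poincare_constant :: "real \<Rightarrow> bool" where
  "poincare_constant C \<longleftrightarrow>
     (\<forall>a r v. torus_Linf a \<and> (AE x in lebesgue. 0 \<le> a x) \<and> 0 < r \<and> r \<le> pi \<and> Theta a r > 0 \<and> torus_H1 v \<longrightarrow>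
        (L2_norm v)\<^sup>2 \<le> C * (inverse (Theta a r) * torus_int (\<lambda>x. a x * (cmod (v x))\<^sup>2)
                             + r\<^sup>2 * (L2_norm (wderiv v))\<^sup>2))"

definition critical_gauge :: "real \<Rightarrow> (real \<Rightarrow> real) \<Rightarrow> bool" where
  "critical_gauge S0 L \<longleftrightarrow>
     1 \<le> S0 \<and> (\<forall>S\<ge>S0. 1 \<le> L S) \<and> (\<forall>S<S0. L S = L S0) \<and>
     (\<exists>l :: real \<Rightarrow> real. (\<forall>u\<ge>1. 1 \<le> l u) \<and> mono_on {1..} l \<and> \<not> bdd_above (l ` {1..}) \<and>
        (\<exists>u0\<ge>1. \<exists>C\<ge>1. \<forall>u\<ge>u0. l (2 * u) \<le> C * l u) \<and>
        (\<forall>S\<ge>S0. L S = l (ln (exp 1 * S))))"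


section \<open>Compact Riemannian manifolds and their Laplace spectrum\<close>

definition pderiv_at :: "'n::finite \<Rightarrow> (real^'n \<Rightarrow> real) \<Rightarrow> real^'n \<Rightarrow> real" where
  "pderiv_at i f x = frechet_derivative f (at x) (axis i 1)"

text \<open>These are intended for open \<open>S\<close>.\<close>

primrec Ck_on :: "nat \<Rightarrow> (real^'n::finite) set \<Rightarrow> (real^'n \<Rightarrow> real) \<Rightarrow> bool" where
  "Ck_on 0 S f = continuous_on S f"
| "Ck_on (Suc k) S f = ((\<forall>x\<in>S. f differentiable (at x)) \<and> (\<forall>i. Ck_on k S (pderiv_at i f)))"

definition smooth_on :: "(real^'n::finite) set \<Rightarrow> (real^'n \<Rightarrow> real) \<Rightarrow> bool" where
  "smooth_on S f \<longleftrightarrow> (\<forall>k. Ck_on k S f)"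

text \<open>A chart is a pair of its domain and its coordinate map.\<close>

type_synonym ('y, 'n) chart = "'y set \<times> ('y \<Rightarrow> real^'n)"

definition smooth_atlas :: "'y topology \<Rightarrow> ('y, 'n::finite) chart set \<Rightarrow> bool" where
  "smooth_atlas Y \<A> \<longleftrightarrow>
     (\<forall>(U, \<phi>)\<in>\<A>. openin Y U \<and> open (\<phi> ` U) \<and>
        homeomorphic_map (subtopology Y U) (top_of_set (\<phi> ` U)) \<phi>) \<and>
     (\<Union>(U, \<phi>)\<in>\<A>. U) = topspace Y \<and>
     (\<forall>(U, \<phi>)\<in>\<A>. \<forall>(V, \<psi>)\<in>\<A>. \<forall>i.
        smooth_on (\<phi> ` (U \<inter> V)) (\<lambda>x. \<psi> (inv_into U \<phi> x) $ i))"

text \<open>\<open>g (U, \<phi>) x\<close> is the Gram matrix of the metric in the chart \<open>(U, \<phi>)\<close> at the point with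
  coordinates \<open>x\<close>; the last clause is the transformation law under a change of coordinates.\<close>

definition riemannian_metric ::
  "('y, 'n::finite) chart set \<Rightarrow> (('y, 'n) chart \<Rightarrow> real^'n \<Rightarrow> real^'n^'n) \<Rightarrow> bool" where
  "riemannian_metric \<A> g \<longleftrightarrow>
     (\<forall>(U, \<phi>)\<in>\<A>.
        (\<forall>i k. smooth_on (\<phi> ` U) (\<lambda>x. g (U, \<phi>) x $ i $ k)) \<and>
        (\<forall>x\<in>\<phi> ` U. transpose (g (U, \<phi>) x) = g (U, \<phi>) x \<and>
           (\<forall>\<xi>. \<xi> \<noteq> 0 \<longrightarrow> 0 < \<xi> \<bullet> (g (U, \<phi>) x *v \<xi>)))) \<and>
     (\<forall>(U, \<phi>)\<in>\<A>. \<forall>(V, \<psi>)\<in>\<A>. \<forall>p\<in>U \<inter> V.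
        (let J = jacobian (\<psi> \<circ> inv_into U \<phi>) (at (\<phi> p))
         in g (U, \<phi>) (\<phi> p) = transpose J ** g (V, \<psi>) (\<psi> p) ** J))"

text \<open>Second countability is automatic in the compact case, and the dimension \<open>CARD('n)\<close> is
  at least one.\<close>

definition compact_connected_riemannian_manifold ::
  "'y topology \<Rightarrow> ('y, 'n::finite) chart set \<Rightarrow> (('y, 'n) chart \<Rightarrow> real^'n \<Rightarrow> real^'n^'n) \<Rightarrow> bool" where
  "compact_connected_riemannian_manifold Y \<A> g \<longleftrightarrow>
     topspace Y \<noteq> {} \<and> Hausdorff_space Y \<and> compact_space Y \<and> connected_space Y \<and>
     smooth_atlas Y \<A> \<and> riemannian_metric \<A> g"

definition smooth_function :: "('y, 'n::finite) chart set \<Rightarrow> ('y \<Rightarrow> real) \<Rightarrow> bool" where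
  "smooth_function \<A> f \<longleftrightarrow> (\<forall>(U, \<phi>)\<in>\<A>. smooth_on (\<phi> ` U) (f \<circ> inv_into U \<phi>))"

text \<open>The Laplace--Beltrami operator
  \<open>1/\<surd>|g| \<Sum>\<^sub>i \<partial>\<^sub>i (\<surd>|g| \<Sum>\<^sub>k g\<^sup>i\<^sup>k \<partial>\<^sub>k f)\<close> in a given chart.\<close>

definition laplace_beltrami ::
  "(('y, 'n::finite) chart \<Rightarrow> real^'n \<Rightarrow> real^'n^'n) \<Rightarrow> ('y, 'n) chart \<Rightarrow> ('y \<Rightarrow> real) \<Rightarrow> 'y \<Rightarrow> real" where
  "laplace_beltrami g c f p =
     (let U = fst c; \<phi> = snd c; F = f \<circ> inv_into U \<phi>
      in 1 / sqrt (det (g c (\<phi> p))) *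
         (\<Sum>i\<in>UNIV. pderiv_at i (\<lambda>x. sqrt (det (g c x)) *
            (\<Sum>k\<in>UNIV. matrix_inv (g c x) $ i $ k * pderiv_at k F x)) (\<phi> p)))"

definition laplace_eigen_eq ::
  "('y, 'n::finite) chart set \<Rightarrow> (('y, 'n) chart \<Rightarrow> real^'n \<Rightarrow> real^'n^'n) \<Rightarrow> real \<Rightarrow> ('y \<Rightarrow> real) \<Rightarrow> bool" where
  "laplace_eigen_eq \<A> g \<mu> f \<longleftrightarrow> smooth_function \<A> f \<and>
     (\<forall>c\<in>\<A>. \<forall>p\<in>fst c. - laplace_beltrami g c f p = \<mu> * f p)"

text \<open>\<open>lam\<close> lists the eigenvalues of \<open>-\<Delta>\<close> in nondecreasing order and with multiplicity: it comes
  with linearly independent eigenfunctions \<open>e j\<close> whose finite linear combinations contain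
  every eigenfunction.\<close>

definition laplace_eigenvalues ::
  "'y topology \<Rightarrow> ('y, 'n::finite) chart set \<Rightarrow> (('y, 'n) chart \<Rightarrow> real^'n \<Rightarrow> real^'n^'n) \<Rightarrow> (nat \<Rightarrow> real) \<Rightarrow> bool" where
  "laplace_eigenvalues Y \<A> g lam \<longleftrightarrow>
     lam 0 = 0 \<and> 0 < lam 1 \<and> mono lam \<and>
     (\<exists>e :: nat \<Rightarrow> 'y \<Rightarrow> real.
        (\<forall>j. laplace_eigen_eq \<A> g (lam j) (e j)) \<and>
        (\<forall>N b. (\<forall>p\<in>topspace Y. (\<Sum>j<N. b j * e j p) = 0) \<longrightarrow> (\<forall>j<N. b j = 0)) \<and>
        (\<forall>\<mu> f. laplace_eigen_eq \<A> g \<mu> f \<longrightarrow>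
           (\<exists>N b. \<forall>p\<in>topspace Y. f p = (\<Sum>j<N. b j * e j p))))"

end

(* On the circle a weak derivative is an honest one: testing against exp (-exp (-n (cos (x-c) - d))),
   which tends to the indicator of an arc, shows that v is the primitive of its weak derivative.
   Integration by parts then turns T_s v - mu v, paired with v, into
   |v'|^2 - mu |v|^2 + i s (int a |v|^2), whose real and imaginary parts give all the identities.

   For the spectral gap it is not necessary to know that the spectrum consists of eigenvalues. Below the
   threshold the Poincare inequality with r^2 = 1/(4 C s) makes the same identity an a priori bound
   |v| <= K |(T_s - mu) v|. Hence T_s - mu is injective, and surjectivity is linear algebra: the
   initial value problem is solved by a contraction, and injectivity makes the 2 x 2 system for
   the periodic boundary conditions solvable. Since 1/r <= s for large s and L is nondecreasing, Theta a r >= c / L s. *)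
theory Submission
  imports Defs "HOL-Complex_Analysis.Cauchy_Integral_Formula"
begin

section \<open>Integration by parts for primitives\<close>

text \<open>Classes are given by representatives and \<open>wderiv\<close> is an arbitrary choice
  among them, so everything about derivatives holds only almost everywhere. For the same reason
  integration by parts cannot go through a pointwise product rule; Fubini takes its place.

  Smoothness of a test function means a whole tower of derivatives. The double exponential is the
  restriction of an entire function, which has the tower for free, and its values stay in [0, 1],
  which is what dominated convergence asks for.

  The resolvent set demands a bijection with bounded inverse, so the absence of eigenfunctions alone
  would not place \<mu> in it; hence the detour through an a priori bound and a solvability theorem.

  The constants come from sharing out the two terms of the Poincare inequality: with r^2 = 1 / (4 C
  s) and Im \<mu> below c / (4 C) * s / L s, each term is at most a quarter of |v|^2, and the
  remaining half controls v.

  In part (b) the imaginary part of the identity is a product with the factor Im z. The lower bound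
  on the frequency is exactly what rules out a real z.\<close>

interpretation lebesgue: sigma_finite_measure "lebesgue :: 'a::euclidean_space measure"
proof
  obtain A :: "'a set set" where A: "countable A" "A \<subseteq> sets lborel" "\<Union>A = space lborel"
      "\<forall>a\<in>A. emeasure lborel a \<noteq> \<infinity>"
    using lborel.sigma_finite_countable by auto
  then show "\<exists>A :: 'a set set. countable A \<and> A \<subseteq> sets lebesgue \<and> \<Union>A = space lebesgue \<and>
      (\<forall>a\<in>A. emeasure lebesgue a \<noteq> \<infinity>)"
    by (intro exI[of _ A]) (auto simp: subset_eq)
qed

text \<open>Representatives are only Lebesgue measurable, so Fubini is set up on the product of two
  copies of the completed measure.\<close>

interpretation lebesgue_pair: pair_sigma_finite "lebesgue :: real measure" "lebesgue :: real measure" ..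

text \<open>After one exchange of the order of integration, both terms are integrals of f t * g x,
  over the half planes t \<le> x and x \<le> t. These fill the plane and overlap in the diagonal
  alone, which each line of constant x meets in one point.\<close>

lemma integral_triangle_sum:
  fixes f g :: "real \<Rightarrow> complex"
  assumes f: "integrable lebesgue f" and g: "integrable lebesgue g"
  shows "(\<integral>x. (\<integral>t. indicator {..x} t *\<^sub>R f t \<partial>lebesgue) * g x \<partial>lebesgue) +
         (\<integral>x. f x * (\<integral>t. indicator {..x} t *\<^sub>R g t \<partial>lebesgue) \<partial>lebesgue) =
         integral\<^sup>L lebesgue f * integral\<^sup>L lebesgue g"
proof -
  let ?M = "(lebesgue :: real measure) \<Otimes>\<^sub>M (lebesgue :: real measure)"
  have [measurable]: "f \<in> borel_measurable lebesgue" "g \<in> borel_measurable lebesgue"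
    using f g by auto
  have int: "integrable ?M (\<lambda>(x,t). f t * g x)"
  proof (rule lebesgue_pair.Fubini_integrable)
    show "(\<lambda>(x,t). f t * g x) \<in> borel_measurable ?M" by measurable
    show "integrable lebesgue (\<lambda>x. \<integral>y. norm (case (x, y) of (x, t) \<Rightarrow> f t * g x) \<partial>lebesgue)"
      using g by (simp add: norm_mult)
    show "AE x in lebesgue. integrable lebesgue (\<lambda>y. case (x, y) of (x, t) \<Rightarrow> f t * g x)"
      using f by simp
  qed
  have id_m: "(\<lambda>x::real. x) \<in> borel_measurable lebesgue"
    by (rule measurable_completion) auto
  have m1 [measurable]: "fst \<in> borel_measurable ?M" "snd \<in> borel_measurable ?M"
    using measurable_compose[OF measurable_fst id_m, of "lebesgue :: real measure"]
      measurable_compose[OF measurable_snd id_m, of "lebesgue :: real measure"] by auto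
  \<comment> \<open>The half planes must be measurable for the product of the Lebesgue
    sigma-algebras; they are, because both projections are measurable into the Borel sets.\<close>
  have s1: "{p. snd p \<le> fst p} \<in> sets ?M"
  proof -
    have "{p\<in>space ?M. snd p \<le> fst p} \<in> sets ?M" by measurable
    then show ?thesis by (simp add: space_pair_measure)
  qed
  have s2: "{p. fst p \<le> snd p} \<in> sets ?M"
  proof -
    have "{p\<in>space ?M. fst p \<le> snd p} \<in> sets ?M" by measurable
    then show ?thesis by (simp add: space_pair_measure)
  qed
  define A where "A = (\<lambda>x t. indicator {..x} t *\<^sub>R (f t * g x))"
  define B where "B = (\<lambda>x t. indicator {x..} t *\<^sub>R (f t * g x))"
  have A: "integrable ?M (case_prod A)"
    using integrable_mult_indicator[OF s1 int]
    by (rule back_subst[of "integrable ?M"]) (auto simp: A_def fun_eq_iff indicator_def)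
  have B: "integrable ?M (case_prod B)"
    using integrable_mult_indicator[OF s2 int]
    by (rule back_subst[of "integrable ?M"]) (auto simp: B_def fun_eq_iff indicator_def)
  have 1: "(\<integral>x. (\<integral>t. indicator {..x} t *\<^sub>R f t \<partial>lebesgue) * g x \<partial>lebesgue) =
      (\<integral>x. (\<integral>t. A x t \<partial>lebesgue) \<partial>lebesgue)"
  proof -
    have "(\<integral>t. indicator {..x} t *\<^sub>R f t \<partial>lebesgue) * g x = (\<integral>t. A x t \<partial>lebesgue)" for x
    proof -
      have "(\<integral>t. indicator {..x} t *\<^sub>R f t \<partial>lebesgue) * g x = (\<integral>t. (indicator {..x} t *\<^sub>R f t) * g x \<partial>lebesgue)"
        by (rule integral_mult_left_zero[symmetric])
      also have "\<dots> = (\<integral>t. A x t \<partial>lebesgue)"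
        by (intro Bochner_Integration.integral_cong) (auto simp: A_def)
      finally show ?thesis .
    qed
    then show ?thesis by simp
  qed
  have 2: "(\<integral>x. f x * (\<integral>t. indicator {..x} t *\<^sub>R g t \<partial>lebesgue) \<partial>lebesgue) =
      (\<integral>t. (\<integral>x. B x t \<partial>lebesgue) \<partial>lebesgue)"
  proof -
    have "f t * (\<integral>x. indicator {..t} x *\<^sub>R g x \<partial>lebesgue) = (\<integral>x. B x t \<partial>lebesgue)" for t
    proof -
      have "f t * (\<integral>x. indicator {..t} x *\<^sub>R g x \<partial>lebesgue) = (\<integral>x. f t * (indicator {..t} x *\<^sub>R g x) \<partial>lebesgue)"
        by (rule integral_mult_right_zero[symmetric])
      also have "\<dots> = (\<integral>x. B x t \<partial>lebesgue)"
        by (intro Bochner_Integration.integral_cong) (auto simp: B_def indicator_def)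
      finally show ?thesis .
    qed
    then show ?thesis by simp
  qed
  have 3: "(\<integral>t. (\<integral>x. B x t \<partial>lebesgue) \<partial>lebesgue) = (\<integral>x. (\<integral>t. B x t \<partial>lebesgue) \<partial>lebesgue)"
    using lebesgue_pair.Fubini_integral[OF B] by simp
  have iA: "integrable lebesgue (\<lambda>t. A x t)" "integrable lebesgue (\<lambda>t. B x t)" for x
    unfolding A_def B_def
    by (intro integrable_mult_indicator; use f in simp)+
  have 4: "(\<integral>t. A x t \<partial>lebesgue) + (\<integral>t. B x t \<partial>lebesgue) = integral\<^sup>L lebesgue f * g x" for x
  proof -
    have "(\<integral>t. A x t \<partial>lebesgue) + (\<integral>t. B x t \<partial>lebesgue) = (\<integral>t. A x t + B x t \<partial>lebesgue)"
      using iA by simp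
    also have "\<dots> = (\<integral>t. f t * g x \<partial>lebesgue)"
    proof (rule integral_cong_AE)
      have "AE t in lebesgue. t \<noteq> x"
        by (rule AE_I[of _ _ "{x}"]) auto
      then show "AE t in lebesgue. A x t + B x t = f t * g x"
        by eventually_elim (auto simp: A_def B_def indicator_def)
      show "(\<lambda>t. A x t + B x t) \<in> borel_measurable lebesgue"
        using iA by (intro borel_measurable_integrable) auto
    qed simp
    finally show ?thesis by simp
  qed
  have "(\<integral>x. (\<integral>t. A x t \<partial>lebesgue) \<partial>lebesgue) + (\<integral>x. (\<integral>t. B x t \<partial>lebesgue) \<partial>lebesgue) =
     (\<integral>x. (\<integral>t. A x t \<partial>lebesgue) + (\<integral>t. B x t \<partial>lebesgue) \<partial>lebesgue)"
    using lebesgue_pair.integrable_fst[OF A] lebesgue_pair.integrable_fst[OF B] by simp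
  also have "\<dots> = integral\<^sup>L lebesgue f * integral\<^sup>L lebesgue g"
    unfolding 4 by simp
  finally show ?thesis unfolding 1 2 3 .
qed

lemma continuous_on_imp_mult_absolutely_integrable:
  fixes F g :: "real \<Rightarrow> complex"
  assumes "continuous_on {a..b} F" "g absolutely_integrable_on {a..b}"
  shows "(\<lambda>x. F x * g x) absolutely_integrable_on {a..b}"
    and "(\<lambda>x. g x * F x) absolutely_integrable_on {a..b}"
proof -
  show *: "(\<lambda>x. F x * g x) absolutely_integrable_on {a..b}"
    by (rule absolutely_integrable_bounded_measurable_product[OF bilinear_times])
      (use assms in \<open>auto intro: continuous_imp_measurable_on_sets_lebesgue compact_imp_bounded compact_continuous_image\<close>)
  show "(\<lambda>x. g x * F x) absolutely_integrable_on {a..b}"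
    using * by (simp add: mult.commute)
qed

lemma absolutely_integrable_on_subinterval_real:
  fixes f :: "real \<Rightarrow> 'a::euclidean_space"
  assumes "f absolutely_integrable_on {a..b}" "{c..d} \<subseteq> {a..b}"
  shows "f absolutely_integrable_on {c..d}" "f integrable_on {c..d}"
  using assms absolutely_integrable_on_subinterval[OF assms]
  by (auto intro: set_lebesgue_integral_eq_integral)

lemma continuous_on_primitive:
  fixes f :: "real \<Rightarrow> complex"
  assumes "f absolutely_integrable_on {a..b}"
  shows "continuous_on {a..b} (\<lambda>x. c + integral {a..x} f)"
  using assms by (intro continuous_intros indefinite_integral_continuous_1 set_lebesgue_integral_eq_integral)

text \<open>As f and g are merely integrable, F and G need not be differentiable everywhere, and the
  identity rests on Fubini. The initial values c and d contribute c * int g + d * int f, which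
  completes int f * int g to F b * G b - c * d.\<close>

lemma integral_by_parts_primitive:
  fixes f g :: "real \<Rightarrow> complex"
  assumes ab: "a \<le> b"
    and f: "f absolutely_integrable_on {a..b}" and g: "g absolutely_integrable_on {a..b}"
    and F: "\<And>x. x \<in> {a..b} \<Longrightarrow> F x = c + integral {a..x} f"
    and G: "\<And>x. x \<in> {a..b} \<Longrightarrow> G x = d + integral {a..x} g"
  shows "integral {a..b} (\<lambda>x. F x * g x) + integral {a..b} (\<lambda>x. f x * G x) = F b * G b - c * d"
proof -
  \<comment> \<open>Cutting off outside [a, b] turns integrals over half lines into integrals from
    a.\<close>
  define f1 where "f1 = (\<lambda>x. indicator {a..b} x *\<^sub>R f x)"
  define g1 where "g1 = (\<lambda>x. indicator {a..b} x *\<^sub>R g x)"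
  have f1: "integrable lebesgue f1" and g1: "integrable lebesgue g1"
    using f g by (auto simp: f1_def g1_def set_integrable_def)
  have P: "(\<integral>t. indicator {..x} t *\<^sub>R (indicator {a..b} t *\<^sub>R h t) \<partial>lebesgue) = integral {a..x} h"
    if "h absolutely_integrable_on {a..b}" "x \<in> {a..b}" for h :: "real \<Rightarrow> complex" and x
  proof -
    have "(\<integral>t. indicator {..x} t *\<^sub>R (indicator {a..b} t *\<^sub>R h t) \<partial>lebesgue) = (LINT t:{a..x}|lebesgue. h t)"
      unfolding set_lebesgue_integral_def
      by (intro Bochner_Integration.integral_cong) (use that in \<open>auto simp: indicator_def\<close>)
    then show ?thesis
      using set_lebesgue_integral_eq_integral(2)[OF absolutely_integrable_on_subinterval_real(1)[OF that(1)]] that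
      by auto
  qed
  have If: "integral\<^sup>L lebesgue f1 = integral {a..b} f" and Ig: "integral\<^sup>L lebesgue g1 = integral {a..b} g"
    using set_lebesgue_integral_eq_integral(2)[OF f] set_lebesgue_integral_eq_integral(2)[OF g]
    by (auto simp: f1_def g1_def set_lebesgue_integral_def)
  let ?Jf = "\<lambda>x. integral {a..x} f" and ?Jg = "\<lambda>x. integral {a..x} g"
  have cf: "continuous_on {a..b} ?Jf" and cg: "continuous_on {a..b} ?Jg"
    using continuous_on_primitive[OF f, of 0] continuous_on_primitive[OF g, of 0] by auto
  note if1 = continuous_on_imp_mult_absolutely_integrable(1)[OF cf g]
  note ig1 = continuous_on_imp_mult_absolutely_integrable(2)[OF cg f]
  have 1: "(\<integral>x. (\<integral>t. indicator {..x} t *\<^sub>R f1 t \<partial>lebesgue) * g1 x \<partial>lebesgue) = integral {a..b} (\<lambda>x. ?Jf x * g x)"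
  proof -
    have "(\<integral>x. (\<integral>t. indicator {..x} t *\<^sub>R f1 t \<partial>lebesgue) * g1 x \<partial>lebesgue) = (LINT x:{a..b}|lebesgue. ?Jf x * g x)"
      unfolding set_lebesgue_integral_def f1_def g1_def
    proof (intro Bochner_Integration.integral_cong refl)
      fix x :: real
      show "(\<integral>t. indicator {..x} t *\<^sub>R (indicator {a..b} t *\<^sub>R f t) \<partial>lebesgue) * (indicator {a..b} x *\<^sub>R g x) = indicator {a..b} x *\<^sub>R (?Jf x * g x)"
        by (cases "x \<in> {a..b}") (simp_all only: P[OF f] indicator_simps, simp_all)
    qed
    then show ?thesis using set_lebesgue_integral_eq_integral(2)[OF if1] by simp
  qed
  have 2: "(\<integral>x. f1 x * (\<integral>t. indicator {..x} t *\<^sub>R g1 t \<partial>lebesgue) \<partial>lebesgue) = integral {a..b} (\<lambda>x. f x * ?Jg x)"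
  proof -
    have "(\<integral>x. f1 x * (\<integral>t. indicator {..x} t *\<^sub>R g1 t \<partial>lebesgue) \<partial>lebesgue) = (LINT x:{a..b}|lebesgue. f x * ?Jg x)"
      unfolding set_lebesgue_integral_def f1_def g1_def
    proof (intro Bochner_Integration.integral_cong refl)
      fix x :: real
      show "(indicator {a..b} x *\<^sub>R f x) * (\<integral>t. indicator {..x} t *\<^sub>R (indicator {a..b} t *\<^sub>R g t) \<partial>lebesgue) = indicator {a..b} x *\<^sub>R (f x * ?Jg x)"
        by (cases "x \<in> {a..b}") (simp_all only: P[OF g] indicator_simps, simp_all)
    qed
    then show ?thesis using set_lebesgue_integral_eq_integral(2)[OF ig1] by simp
  qed
  have 3: "integral {a..b} (\<lambda>x. ?Jf x * g x) + integral {a..b} (\<lambda>x. f x * ?Jg x) = integral {a..b} f * integral {a..b} g"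
    using integral_triangle_sum[OF f1 g1] unfolding 1 2 If Ig .
  have 4: "integral {a..b} (\<lambda>x. F x * g x) = c * integral {a..b} g + integral {a..b} (\<lambda>x. ?Jf x * g x)"
  proof -
    have "integral {a..b} (\<lambda>x. F x * g x) = integral {a..b} (\<lambda>x. c * g x + ?Jf x * g x)"
      by (rule Henstock_Kurzweil_Integration.integral_cong) (simp add: F algebra_simps)
    also have "\<dots> = integral {a..b} (\<lambda>x. c * g x) + integral {a..b} (\<lambda>x. ?Jf x * g x)"
      by (intro Henstock_Kurzweil_Integration.integral_add integrable_on_mult_right
          set_lebesgue_integral_eq_integral(1)[OF g] set_lebesgue_integral_eq_integral(1)[OF if1])
    finally show ?thesis by simp
  qed
  have 5: "integral {a..b} (\<lambda>x. f x * G x) = integral {a..b} f * d + integral {a..b} (\<lambda>x. f x * ?Jg x)"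
  proof -
    have "integral {a..b} (\<lambda>x. f x * G x) = integral {a..b} (\<lambda>x. f x * d + f x * ?Jg x)"
      by (rule Henstock_Kurzweil_Integration.integral_cong) (simp add: G algebra_simps)
    also have "\<dots> = integral {a..b} (\<lambda>x. f x * d) + integral {a..b} (\<lambda>x. f x * ?Jg x)"
      by (intro Henstock_Kurzweil_Integration.integral_add integrable_on_mult_left
          set_lebesgue_integral_eq_integral(1)[OF f] set_lebesgue_integral_eq_integral(1)[OF ig1])
    finally show ?thesis by simp
  qed
  show ?thesis
    unfolding 4 5 using 3 F[of b] G[of b] ab by (simp add: algebra_simps)
qed

text \<open>Henstock's lemma bounds the sum of the local errors |measure K * h x - int_K h| over a
  fine tagged division. Since int_K h = 0, this sum is a Riemann sum of |h|, so |h| itself has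
  integral 0.\<close>

lemma zero_interval_integrals_imp_AE_zero:
  fixes h :: "real \<Rightarrow> complex"
  assumes h: "h absolutely_integrable_on {a..b}"
    and zero: "\<And>c d. a \<le> c \<Longrightarrow> c \<le> d \<Longrightarrow> d \<le> b \<Longrightarrow> integral {c..d} h = 0"
  shows "AE x in lebesgue. x \<in> {a..b} \<longrightarrow> h x = 0"
proof -
  have hi: "h integrable_on cbox a b" using h set_lebesgue_integral_eq_integral(1) by auto
  have "((\<lambda>x. norm (h x)) has_integral 0) (cbox a b)"
    unfolding has_integral
  proof (intro allI impI)
    fix e :: real assume "e > 0"
    obtain \<gamma> where \<gamma>: "gauge \<gamma>" "\<And>p. p tagged_partial_division_of (cbox a b) \<Longrightarrow> \<gamma> fine p \<Longrightarrow>
             sum (\<lambda>(x,k). norm (measure lborel k *\<^sub>R h x - integral k h)) p < e"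
      using Henstock_lemma[OF hi \<open>e > 0\<close>] by blast
    have "norm ((\<Sum>(x,k)\<in>p. measure lborel k *\<^sub>R norm (h x)) - 0) < e"
      if p: "p tagged_division_of cbox a b" "\<gamma> fine p" for p
    proof -
      have "(\<Sum>(x,k)\<in>p. measure lborel k *\<^sub>R norm (h x)) = (\<Sum>(x,k)\<in>p. norm (measure lborel k *\<^sub>R h x - integral k h))"
      proof (rule sum.cong, simp, clarify)
        fix x K assume "(x, K) \<in> p"
        note K' = tagged_division_ofD(2-4)[OF p(1) this]
        obtain c d where K: "K = cbox c d" "K \<subseteq> cbox a b" "x \<in> K"
          using K'(1,2) K'(3) by auto
        then have "integral K h = 0" using zero[of c d] by (cases "c \<le> d") auto
        then show "measure lborel K *\<^sub>R norm (h x) = norm (measure lborel K *\<^sub>R h x - integral K h)" by simp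
      qed
      also have "\<dots> < e" using \<gamma>(2)[OF _ p(2)] p(1) unfolding tagged_division_of_def by blast
      finally have "(\<Sum>(x,k)\<in>p. measure lborel k *\<^sub>R norm (h x)) < e" .
      moreover have "0 \<le> (\<Sum>(x,k)\<in>p. measure lborel k *\<^sub>R norm (h x))"
        by (rule sum_nonneg) auto
      ultimately show ?thesis by simp
    qed
    then show "\<exists>\<gamma>. gauge \<gamma> \<and> (\<forall>p. p tagged_division_of cbox a b \<and> \<gamma> fine p \<longrightarrow>
      norm ((\<Sum>(x,k)\<in>p. measure lborel k *\<^sub>R norm (h x)) - 0) < e)"
      using \<gamma>(1) by (intro exI[of _ \<gamma>]) auto
  qed
  then have "integral {a..b} (\<lambda>x. norm (h x)) = 0" by auto
  moreover have n: "(\<lambda>x. norm (h x)) absolutely_integrable_on {a..b}"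
    using h by (rule absolutely_integrable_norm[unfolded o_def])
  ultimately have "(LINT x|lebesgue. norm (indicator {a..b} x *\<^sub>R h x)) = 0"
    using set_lebesgue_integral_eq_integral(2)[OF n] by (simp add: set_lebesgue_integral_def)
  then have "AE x in lebesgue. indicator {a..b} x *\<^sub>R h x = 0"
    using integral_nonneg_eq_0_iff_AE[OF integrable_norm[OF h[unfolded set_integrable_def]]] by simp
  then show ?thesis by eventually_elim auto
qed


section \<open>Square-integrable functions on the circle\<close>

lemma borel_measurable_lebesgue_on: "f \<in> borel_measurable lebesgue \<Longrightarrow> f \<in> borel_measurable (lebesgue_on S)"
  by (rule measurable_restrict_space1)

lemma torus_L2_measurable: "torus_L2 f \<Longrightarrow> f \<in> borel_measurable lebesgue"
  by (simp add: torus_L2_def torus_fun_def)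

lemma torus_L2_periodic: "torus_L2 f \<Longrightarrow> f (x + 2 * pi) = f x"
  by (simp add: torus_L2_def torus_fun_def)

lemma torus_L2_square: "torus_L2 f \<Longrightarrow> (\<lambda>x. (cmod (f x))\<^sup>2) absolutely_integrable_on {0..2*pi}"
  by (simp add: torus_L2_def)

lemma torus_int_eq_integral:
  fixes f :: "real \<Rightarrow> 'a::euclidean_space"
  shows "f absolutely_integrable_on {0..2*pi} \<Longrightarrow> torus_int f = integral {0..2*pi} f"
  unfolding torus_int_def by (rule set_lebesgue_integral_eq_integral(2))

lemma torus_int_cong_AE:
  fixes f g :: "real \<Rightarrow> 'a::{banach, second_countable_topology}"
  assumes "f \<in> borel_measurable lebesgue" "g \<in> borel_measurable lebesgue" "AE x in lebesgue. f x = g x"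
  shows "torus_int f = torus_int g"
  unfolding torus_int_def set_lebesgue_integral_def
proof (rule integral_cong_AE)
  have [measurable]: "{0..2*pi} \<in> sets lebesgue" "f \<in> borel_measurable lebesgue" "g \<in> borel_measurable lebesgue"
    using assms by auto
  show "(\<lambda>x. indicator {0..2*pi} x *\<^sub>R f x) \<in> borel_measurable lebesgue"
       "(\<lambda>x. indicator {0..2*pi} x *\<^sub>R g x) \<in> borel_measurable lebesgue"
    by measurable
  show "AE x in lebesgue. indicator {0..2*pi} x *\<^sub>R f x = indicator {0..2*pi} x *\<^sub>R g x"
    using assms(3) by eventually_elim simp
qed

lemma torus_L2_mult_integrable:
  assumes "torus_L2 f" "torus_L2 g"
  shows "(\<lambda>x. f x * g x) absolutely_integrable_on {0..2*pi}"
proof (rule measurable_bounded_by_integrable_imp_absolutely_integrable)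
  have [measurable]: "f \<in> borel_measurable lebesgue" "g \<in> borel_measurable lebesgue"
    using assms torus_L2_measurable by auto
  show "(\<lambda>x. f x * g x) \<in> borel_measurable (lebesgue_on {0..2*pi})"
    by (rule borel_measurable_lebesgue_on) measurable
  show "(\<lambda>x. (cmod (f x))\<^sup>2 + (cmod (g x))\<^sup>2) integrable_on {0..2*pi}"
    by (intro integrable_add set_lebesgue_integral_eq_integral(1) torus_L2_square assms)
  show "cmod (f x * g x) \<le> (cmod (f x))\<^sup>2 + (cmod (g x))\<^sup>2" for x
  proof -
    have "2 * cmod (f x) * cmod (g x) \<le> (cmod (f x))\<^sup>2 + (cmod (g x))\<^sup>2"
      by (rule sum_squares_bound)
    moreover have "0 \<le> cmod (f x) * cmod (g x)" by simp
    ultimately show ?thesis unfolding norm_mult by linarith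
  qed
qed auto

lemma torus_L2_const [simp]: "torus_L2 (\<lambda>_. c)"
  by (auto simp: torus_L2_def torus_fun_def)

lemma torus_L2_imp_absolutely_integrable:
  "torus_L2 f \<Longrightarrow> f absolutely_integrable_on {0..2*pi}"
  using torus_L2_mult_integrable[of f "\<lambda>_. 1"] by simp

text \<open>Two dominating functions make this serve sums as well as products with bounded
  functions, where both are taken equal.\<close>

lemma torus_L2_dominated:
  assumes "torus_fun f" "torus_L2 g" "torus_L2 h"
    and "AE x in lebesgue. cmod (f x) \<le> C * (cmod (g x) + cmod (h x))"
  shows "torus_L2 f"
  unfolding torus_L2_def
proof
  have [measurable]: "f \<in> borel_measurable lebesgue" "g \<in> borel_measurable lebesgue"
    "{0..2*pi} \<in> sets lebesgue"
    using assms torus_L2_measurable by (auto simp: torus_fun_def)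
  show "(\<lambda>x. (cmod (f x))\<^sup>2) absolutely_integrable_on {0..2*pi}"
    unfolding set_integrable_def
  proof (rule Bochner_Integration.integrable_bound)
    show "integrable lebesgue (\<lambda>x. 2 * C\<^sup>2 * (indicator {0..2*pi} x *\<^sub>R (cmod (g x))\<^sup>2 + indicator {0..2*pi} x *\<^sub>R (cmod (h x))\<^sup>2))"
      using assms torus_L2_square unfolding set_integrable_def
      by (intro integrable_mult_right Bochner_Integration.integrable_add) auto
    show "(\<lambda>x. indicator {0..2*pi} x *\<^sub>R (cmod (f x))\<^sup>2) \<in> borel_measurable lebesgue"
      by measurable
    show "AE x in lebesgue. norm (indicator {0..2*pi} x *\<^sub>R (cmod (f x))\<^sup>2)
       \<le> norm (2 * C\<^sup>2 * (indicator {0..2*pi} x *\<^sub>R (cmod (g x))\<^sup>2 + indicator {0..2*pi} x *\<^sub>R (cmod (h x))\<^sup>2))"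
      using assms(4)
    proof eventually_elim
      case (elim x)
      have "(cmod (f x))\<^sup>2 \<le> (C * (cmod (g x) + cmod (h x)))\<^sup>2"
        using elim by (intro power_mono) auto
      also have "\<dots> = C\<^sup>2 * (cmod (g x) + cmod (h x))\<^sup>2" by (simp add: power_mult_distrib)
      also have "\<dots> \<le> C\<^sup>2 * (2 * ((cmod (g x))\<^sup>2 + (cmod (h x))\<^sup>2))"
        using sum_squares_bound[of "cmod (g x)" "cmod (h x)"]
        by (intro mult_left_mono) (auto simp: power2_sum)
      finally show ?case by (auto simp: indicator_def algebra_simps)
    qed
  qed
qed fact

lemma torus_L2_add:
  assumes "torus_L2 f" "torus_L2 g"
  shows "torus_L2 (\<lambda>x. f x + g x)"
  by (rule torus_L2_dominated[OF _ assms, of _ 1])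
    (use assms in \<open>auto simp: torus_L2_def torus_fun_def norm_triangle_ineq\<close>)

lemma torus_L2_bounded_mult:
  assumes "torus_fun b" "AE x in lebesgue. cmod (b x) \<le> M" "torus_L2 f"
  shows "torus_L2 (\<lambda>x. b x * f x)"
proof (rule torus_L2_dominated[OF _ assms(3) assms(3), of _ M])
  show "torus_fun (\<lambda>x. b x * f x)"
    using assms by (auto simp: torus_L2_def torus_fun_def)
  show "AE x in lebesgue. cmod (b x * f x) \<le> M * (cmod (f x) + cmod (f x))"
    using assms(2)
  proof eventually_elim
    case (elim x)
    have "0 \<le> M" using elim norm_ge_zero order_trans by blast
    then have "0 \<le> M * cmod (f x)" by simp
    moreover have "cmod (b x * f x) \<le> M * cmod (f x)"
      using elim by (simp add: norm_mult mult_right_mono)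
    ultimately show ?case by (simp add: distrib_left)
  qed
qed

lemma torus_L2_scale: "torus_L2 f \<Longrightarrow> torus_L2 (\<lambda>x. c * f x)"
  by (rule torus_L2_bounded_mult[where M = "cmod c"]) (auto simp: torus_fun_def)

lemma torus_L2_uminus: "torus_L2 f \<Longrightarrow> torus_L2 (\<lambda>x. - f x)"
  using torus_L2_scale[of f "-1"] by simp

lemma torus_L2_diff: "torus_L2 f \<Longrightarrow> torus_L2 g \<Longrightarrow> torus_L2 (\<lambda>x. f x - g x)"
  using torus_L2_add[OF _ torus_L2_uminus] by fastforce

lemma torus_L2_cnj: "torus_L2 f \<Longrightarrow> torus_L2 (\<lambda>x. cnj (f x))"
  unfolding torus_L2_def torus_fun_def by (auto intro: borel_measurable_continuous_on continuous_intros)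

section \<open>Linearity of the circle integral, and the L2 norm\<close>

lemma torus_int_add:
  fixes f g :: "real \<Rightarrow> 'a::{banach, second_countable_topology}"
  shows "f absolutely_integrable_on {0..2*pi} \<Longrightarrow> g absolutely_integrable_on {0..2*pi} \<Longrightarrow>
    torus_int (\<lambda>x. f x + g x) = torus_int f + torus_int g"
  unfolding torus_int_def by (rule set_integral_add)

lemma torus_int_diff:
  fixes f g :: "real \<Rightarrow> 'a::{banach, second_countable_topology}"
  shows "f absolutely_integrable_on {0..2*pi} \<Longrightarrow> g absolutely_integrable_on {0..2*pi} \<Longrightarrow>
    torus_int (\<lambda>x. f x - g x) = torus_int f - torus_int g"
  unfolding torus_int_def by (rule set_integral_diff)

lemma torus_int_mult:
  fixes f :: "real \<Rightarrow> 'a::{real_normed_field, banach, second_countable_topology}"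
  shows "torus_int (\<lambda>x. c * f x) = c * torus_int f"
  unfolding torus_int_def by (rule set_integral_mult_right)

lemma L2_norm_square: "(L2_norm f)\<^sup>2 = torus_int (\<lambda>x. (cmod (f x))\<^sup>2)"
proof -
  have "0 \<le> torus_int (\<lambda>x. (cmod (f x))\<^sup>2)"
    unfolding torus_int_def set_lebesgue_integral_def by (intro integral_nonneg_AE) auto
  then show ?thesis by (simp add: L2_norm_def)
qed

lemma L2_norm_nonneg [simp]: "0 \<le> L2_norm f"
  unfolding L2_norm_def torus_int_def set_lebesgue_integral_def
  by (intro real_sqrt_ge_zero integral_nonneg_AE) auto

text \<open>\<open>torus_eq\<close> speaks of the whole line, whereas integrals see one period. The
  exceptional set is covered by the translates of its part in one period, and there are countably
  many.\<close>

lemma torus_AE: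
  assumes per: "\<And>x. P (x + 2 * pi) = P x" and ae: "AE x in lebesgue. x \<in> {0..2*pi} \<longrightarrow> P x"
  shows "AE x in lebesgue. P x"
proof -
  define N where "N = {x \<in> {0..2*pi}. \<not> P x}"
  have "negligible N"
  proof -
    obtain N' where N': "N' \<in> null_sets lebesgue" "{x \<in> space lebesgue. \<not> (x \<in> {0..2*pi} \<longrightarrow> P x)} \<subseteq> N'"
      using ae unfolding eventually_ae_filter by blast
    then have "negligible N'" by (simp add: negligible_iff_null_sets)
    then show ?thesis by (rule negligible_subset) (use N'(2) in \<open>auto simp: N_def\<close>)
  qed
  have shift: "P (x + 2 * pi * of_int k) = P x" for x and k :: int
  proof (induction k rule: int_induct[where k = 0])
    case (step1 i)
    show ?case using per[of "x + 2 * pi * of_int i"] step1 by (simp add: algebra_simps)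
  next
    case (step2 i)
    show ?case using per[of "x + 2 * pi * of_int (i - 1)"] step2 by (simp add: algebra_simps)
  qed simp
  have "negligible (\<Union>k::int. (+) (2 * pi * of_int k) ` N)"
    using \<open>negligible N\<close> by (intro negligible_countable_Union) (auto intro: negligible_translation)
  moreover have "{x. \<not> P x} \<subseteq> (\<Union>k::int. (+) (2 * pi * of_int k) ` N)"
  proof
    fix x assume x: "x \<in> {x. \<not> P x}"
    define k where "k = \<lfloor>x / (2 * pi)\<rfloor>"
    define y where "y = x - 2 * pi * of_int k"
    have "of_int k \<le> x / (2 * pi)" "x / (2 * pi) < of_int k + 1"
      unfolding k_def by linarith+
    then have "2 * pi * of_int k \<le> x" "x < 2 * pi * of_int k + 2 * pi"
      by (simp_all add: field_simps)
    then have "y \<in> {0..2*pi}" by (auto simp: y_def)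
    moreover have "\<not> P y" using shift[of y k] x by (simp add: y_def)
    ultimately have "y \<in> N" by (simp add: N_def)
    then show "x \<in> (\<Union>k::int. (+) (2 * pi * of_int k) ` N)"
      by (intro UN_I[of k] image_eqI[of _ _ y]) (auto simp: y_def)
  qed
  ultimately have "negligible {x. \<not> P x}" by (rule negligible_subset)
  then show ?thesis
    by (intro AE_I'[of "{x. \<not> P x}"]) (auto simp: negligible_iff_null_sets)
qed

lemma torus_eqI:
  assumes "\<And>x. f (x + 2 * pi) = f x" "\<And>x. g (x + 2 * pi) = g x"
    "AE x in lebesgue. x \<in> {0..2*pi} \<longrightarrow> f x = g x"
  shows "torus_eq f g"
  unfolding torus_eq_def by (rule torus_AE) (simp_all only: assms)

lemma L2_norm_eq_0_imp:
  assumes "torus_L2 f" "L2_norm f = 0"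
  shows "torus_eq f (\<lambda>_. 0)"
proof (rule torus_eqI)
  have "(LINT x|lebesgue. indicator {0..2*pi} x *\<^sub>R (cmod (f x))\<^sup>2) = 0"
    using L2_norm_square[of f] assms(2) by (simp add: torus_int_def set_lebesgue_integral_def)
  then have "AE x in lebesgue. indicator {0..2*pi} x *\<^sub>R (cmod (f x))\<^sup>2 = 0"
    using integral_nonneg_eq_0_iff_AE[OF torus_L2_square[OF assms(1), unfolded set_integrable_def]] by simp
  then show "AE x in lebesgue. x \<in> {0..2*pi} \<longrightarrow> f x = 0"
    by eventually_elim auto
qed (use assms torus_L2_periodic in auto)

lemma L2_norm_pos: "torus_L2 f \<Longrightarrow> \<not> torus_eq f (\<lambda>_. 0) \<Longrightarrow> 0 < L2_norm f"
  using L2_norm_eq_0_imp[of f] L2_norm_nonneg[of f] by linarith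

lemma L2_norm_cong:
  assumes "f \<in> borel_measurable lebesgue" "g \<in> borel_measurable lebesgue" "torus_eq f g"
  shows "L2_norm f = L2_norm g"
  unfolding L2_norm_def
  by (rule arg_cong[where f = sqrt], rule torus_int_cong_AE) (use assms in \<open>auto simp: torus_eq_def\<close>)

section \<open>Test functions\<close>

lemma torus_smooth_derivative:
  assumes "torus_smooth \<phi>"
  shows "(\<phi> has_vector_derivative vector_derivative \<phi> (at x)) (at x)"
    "continuous_on UNIV (\<lambda>x. vector_derivative \<phi> (at x))" "continuous_on UNIV \<phi>"
    "\<phi> (x + 2 * pi) = \<phi> x"
proof -
  obtain D where D: "D 0 = \<phi>" "\<And>n x. (D n has_vector_derivative D (Suc n) x) (at x)"
    using assms by (auto simp: torus_smooth_def)
  have eq: "vector_derivative \<phi> (at x) = D 1 x" for x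
    using D(2)[of 0 x] D(1) by (auto intro: vector_derivative_at)
  show "(\<phi> has_vector_derivative vector_derivative \<phi> (at x)) (at x)"
    using D(2)[of 0 x] D(1) eq by simp
  have cont: "continuous_on UNIV (D n)" for n
    using D(2) by (intro continuous_at_imp_continuous_on ballI has_vector_derivative_continuous)
  show "continuous_on UNIV (\<lambda>x. vector_derivative \<phi> (at x))" "continuous_on UNIV \<phi>"
    using cont[of 1] cont[of 0] D(1) eq by auto
  show "\<phi> (x + 2 * pi) = \<phi> x" using assms by (simp add: torus_smooth_def)
qed

lemma torus_smooth_primitive:
  assumes "torus_smooth \<phi>" "0 \<le> x"
  shows "\<phi> x = \<phi> 0 + integral {0..x} (\<lambda>t. vector_derivative \<phi> (at t))"
proof -
  have "((\<lambda>t. vector_derivative \<phi> (at t)) has_integral (\<phi> x - \<phi> 0)) {0..x}"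
    using assms torus_smooth_derivative(1)
    by (intro fundamental_theorem_of_calculus) (auto intro: has_vector_derivative_at_within)
  then show ?thesis by (simp add: integral_unique)
qed

lemma torus_smooth_const: "torus_smooth (\<lambda>_. c)"
  unfolding torus_smooth_def
  by (auto intro!: exI[of _ "\<lambda>n x. if n = 0 then c else 0"])

text \<open>The higher complex derivatives, restricted to the real axis, are the tower that
  \<open>torus_smooth\<close> asks for.\<close>

lemma torus_smooth_holomorphic:
  assumes "F holomorphic_on UNIV" "\<And>x. F (of_real (x + 2 * pi)) = F (of_real x)"
  shows "torus_smooth (\<lambda>x. F (of_real x))"
  unfolding torus_smooth_def
proof (intro conjI exI allI)
  fix n :: nat and x :: real
  have "((deriv ^^ n) F has_field_derivative (deriv ^^ (Suc n)) F (of_real x)) (at (of_real x))"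
    by (rule has_field_derivative_higher_deriv[OF assms(1)]) auto
  then show "((\<lambda>x. (deriv ^^ n) F (of_real x)) has_vector_derivative (deriv ^^ (Suc n)) F (of_real x)) (at x)"
    by (rule has_vector_derivative_real_field)
qed (use assms(2) in auto)

text \<open>As \<open>n\<close> grows these test functions tend to the indicator of \<open>cos (x - c) > d\<close>.\<close>

definition bump :: "real \<Rightarrow> real \<Rightarrow> nat \<Rightarrow> real \<Rightarrow> real" where
  "bump c d n x = exp (- exp (- (real n * (cos (x - c) - d))))"

lemma torus_smooth_bump: "torus_smooth (\<lambda>x. of_real (bump c d n x))"
proof -
  define F :: "complex \<Rightarrow> complex" where
    "F = (\<lambda>z. exp (- exp (- (of_real (real n) * (cos (z - of_real c) - of_real d)))))"
  have eq: "F (of_real x) = of_real (bump c d n x)" for x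
    by (simp only: F_def bump_def exp_of_real[symmetric] cos_of_real[symmetric] of_real_diff of_real_mult of_real_minus)
  have per: "bump c d n (x + 2 * pi) = bump c d n x" for x
  proof -
    have "cos (x + 2 * pi - c) = cos (x - c)" using cos_periodic[of "x - c"] by (simp add: algebra_simps)
    then show ?thesis by (simp add: bump_def)
  qed
  have "torus_smooth (\<lambda>x. F (of_real x))"
  proof (rule torus_smooth_holomorphic)
    show "F holomorphic_on UNIV" unfolding F_def by (intro holomorphic_intros)
    show "F (of_real (x + 2 * pi)) = F (of_real x)" for x
      unfolding eq per ..
  qed
  then show ?thesis by (simp only: eq)
qed

lemma bump_bound: "0 \<le> bump c d n x" "bump c d n x \<le> 1"
  by (auto simp: bump_def)

text \<open>The inner exponential tends to 0 or to infinity according to the sign of cos (x - c) -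
  d. Equality is left out: there the value is exp (-1) for every n.\<close>

lemma bump_tendsto:
  "cos (x - c) > d \<Longrightarrow> (\<lambda>n. bump c d n x) \<longlonglongrightarrow> 1"
  "cos (x - c) < d \<Longrightarrow> (\<lambda>n. bump c d n x) \<longlonglongrightarrow> 0"
proof -
  assume "cos (x - c) > d"
  then have "0 < cos (x - c) - d" by simp
  then show "(\<lambda>n. bump c d n x) \<longlonglongrightarrow> 1"
    unfolding bump_def by real_asymp
next
  assume "cos (x - c) < d"
  then have "cos (x - c) - d < 0" by simp
  then show "(\<lambda>n. bump c d n x) \<longlonglongrightarrow> 0"
    unfolding bump_def by real_asymp
qed

text \<open>A primitive of a periodic function grows by a fixed amount per period, namely the
  integral over one period.\<close>

lemma torus_smooth_antiderivative:
  assumes \<psi>: "torus_smooth \<psi>" and mean: "integral {0..2*pi} \<psi> = 0"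
  obtains \<phi> where "torus_smooth \<phi>" "\<And>x. vector_derivative \<phi> (at x) = \<psi> x"
proof -
  obtain D where D: "D 0 = \<psi>" "\<And>n x. (D n has_vector_derivative D (Suc n) x) (at x)"
    using \<psi> by (auto simp: torus_smooth_def)
  \<comment> \<open>The oriented interval integral gives a primitive on the whole line, negative x
    included.\<close>
  define \<phi> where "\<phi> = (\<lambda>x. LBINT y=ereal 0..ereal x. \<psi> y)"
  have c: "continuous_on S \<psi>" for S
    using torus_smooth_derivative(3)[OF \<psi>] continuous_on_subset by blast
  have der: "(\<phi> has_vector_derivative \<psi> x) (at x)" for x
  proof -
    have "(\<phi> has_vector_derivative \<psi> x) (at x within {-\<bar>x\<bar>-1..\<bar>x\<bar>+1})"
      unfolding \<phi>_def by (rule interval_integral_FTC2) (auto intro: c)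
    moreover have "at x within {-\<bar>x\<bar>-1..\<bar>x\<bar>+1} = at x"
      by (rule at_within_interior) auto
    ultimately show ?thesis by simp
  qed
  have "((\<lambda>x. \<phi> (x + 2 * pi) - \<phi> x) has_vector_derivative 0) (at y within UNIV)" for y
  proof -
    have "((\<lambda>x. \<phi> (x + 2 * pi)) has_vector_derivative \<psi> y) (at y)"
      using vector_diff_chain_at[of "\<lambda>x. x + 2 * pi" 1 y \<phi> "\<psi> (y + 2 * pi)", OF _ der]
        torus_smooth_derivative(4)[OF \<psi>, of y]
      by (simp add: o_def has_vector_derivative_add_const has_vector_derivative_id)
    then show ?thesis
      using has_vector_derivative_diff[OF _ der[of y]] by fastforce
  qed
  then obtain k where k: "\<And>x. \<phi> (x + 2 * pi) - \<phi> x = k"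
    using has_vector_derivative_zero_constant[of UNIV "\<lambda>x. \<phi> (x + 2 * pi) - \<phi> x"] by auto
  moreover have "\<phi> (2 * pi) = \<phi> 0"
  proof -
    have "(\<psi> has_integral (\<phi> (2 * pi) - \<phi> 0)) {0..2*pi}"
      by (rule fundamental_theorem_of_calculus) (auto intro: der has_vector_derivative_at_within)
    with mean show ?thesis by (simp add: integral_unique)
  qed
  ultimately have "\<phi> (x + 2 * pi) = \<phi> x" for x using k[of 0] k[of x] by simp
  then have "torus_smooth \<phi>"
    unfolding torus_smooth_def using D der
    by (intro conjI allI exI[of _ "\<lambda>n. case n of 0 \<Rightarrow> \<phi> | Suc m \<Rightarrow> D m"]) (auto split: nat.splits)
  then show ?thesis using that der vector_derivative_at by blast
qed

text \<open>The bumps of an arc converge to its indicator away from its ends, with |h| as dominating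
  function; so h has integral 0 over every subinterval of the period.\<close>

lemma orthogonal_to_smooth_imp_AE_zero:
  fixes h :: "real \<Rightarrow> complex"
  assumes h: "h absolutely_integrable_on {0..2*pi}"
    and orth: "\<And>\<psi>. torus_smooth \<psi> \<Longrightarrow> integral {0..2*pi} (\<lambda>x. h x * \<psi> x) = 0"
  shows "AE x in lebesgue. x \<in> {0..2*pi} \<longrightarrow> h x = 0"
proof (rule zero_interval_integrals_imp_AE_zero[OF h])
  fix \<alpha> \<beta> :: real assume ab: "0 \<le> \<alpha>" "\<alpha> \<le> \<beta>" "\<beta> \<le> 2 * pi"
  \<comment> \<open>Midpoint and half-length: modulo 2 pi the arc is the set where cos (x - c) \<ge>
    cos \<delta>.\<close>
  define c \<delta> where "c = (\<alpha> + \<beta>) / 2" and "\<delta> = (\<beta> - \<alpha>) / 2"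
  have \<delta>: "0 \<le> \<delta>" "\<delta> \<le> pi" using ab by (auto simp: \<delta>_def)
  \<comment> \<open>At \<alpha> and \<beta> the bumps do not tend to the indicator. The points 0 and
    2 pi are the same on the circle, so either may be a second copy of such an end. On these four
    points everything is set to 0, which gives convergence at every point.\<close>
  define N where "N = {0, 2*pi, \<alpha>, \<beta>}"
  let ?f = "\<lambda>n x. h x * of_real (bump c (cos \<delta>) n x)"
  let ?g = "\<lambda>x. if x \<in> {\<alpha>..\<beta>} then h x else 0"
  let ?f' = "\<lambda>n x. if x \<in> N then 0 else ?f n x" and ?g' = "\<lambda>x. if x \<in> N then 0 else ?g x"
  have negN: "negligible N" by (simp add: N_def)
  have lim: "(\<lambda>n. bump c (cos \<delta>) n x) \<longlonglongrightarrow> (if x \<in> {\<alpha>..\<beta>} then 1 else 0)"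
    if x: "x \<in> {0..2*pi}" "x \<notin> N" for x
  proof (cases "x \<in> {\<alpha>..\<beta>}")
    case True
    then have "\<bar>x - c\<bar> < \<delta>" using x by (auto simp: c_def \<delta>_def N_def abs_if field_simps)
    then have "cos \<delta> < cos \<bar>x - c\<bar>"
      using \<delta> by (intro cos_monotone_0_pi) auto
    then show ?thesis using True bump_tendsto(1)[of "cos \<delta>" x c] by simp
  next
    case False
    have y: "\<delta> < \<bar>x - c\<bar>" "\<bar>x - c\<bar> < 2 * pi - \<delta>"
      using False x ab by (auto simp: c_def \<delta>_def N_def abs_if field_simps)
    have "cos \<bar>x - c\<bar> < cos \<delta>"
    proof (cases "\<bar>x - c\<bar> \<le> pi")
      case True
      then show ?thesis using y \<delta> by (intro cos_monotone_0_pi) auto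
    next
      case 2: False
      \<comment> \<open>Beyond the antipode of c the distance on the circle is 2 pi - |x - c|; it
        lies in [0, pi], where cos decreases.\<close>
      have "cos (2 * pi - \<bar>x - c\<bar>) < cos \<delta>" using y \<delta> 2 by (intro cos_monotone_0_pi) auto
      then show ?thesis by (simp add: cos_diff)
    qed
    then have "cos (x - c) < cos \<delta>" by simp
    then show ?thesis using False bump_tendsto(2)[of x c "cos \<delta>"] by (simp only: if_False)
  qed
  have fi: "?f n absolutely_integrable_on {0..2*pi}" for n
    by (rule continuous_on_imp_mult_absolutely_integrable(2)[OF _ h])
      (auto simp: bump_def intro!: continuous_intros)
  have fi': "?f' n integrable_on {0..2*pi}" for n
    by (rule integrable_spike[OF set_lebesgue_integral_eq_integral(1)[OF fi] negN]) auto
  have hn: "(\<lambda>x. norm (h x)) integrable_on {0..2*pi}"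
    using h by (rule absolutely_integrable_on_def[THEN iffD1, THEN conjunct2])
  have bd: "norm (?f' n x) \<le> norm (h x)" if "x \<in> {0..2*pi}" for n x
    using bump_bound[of c "cos \<delta>" n x] by (auto simp: norm_mult intro: mult_left_le)
  have li: "(\<lambda>n. ?f' n x) \<longlonglongrightarrow> ?g' x" if "x \<in> {0..2*pi}" for x
  proof (cases "x \<in> N")
    case False
    have "(\<lambda>n. ?f n x) \<longlonglongrightarrow> h x * of_real (if x \<in> {\<alpha>..\<beta>} then 1 else 0)"
      using lim[OF that False] by (intro tendsto_intros)
    then show ?thesis using False by (auto split: if_splits)
  qed simp
  have "(\<lambda>n. integral {0..2*pi} (?f' n)) \<longlonglongrightarrow> integral {0..2*pi} ?g'"
    by (rule dominated_convergence(2)[OF fi' hn bd li])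
  moreover have "integral {0..2*pi} (?f' n) = 0" for n
  proof -
    have "integral {0..2*pi} (?f' n) = integral {0..2*pi} (?f n)"
      by (rule integral_spike[OF negN]) auto
    then show ?thesis using orth[OF torus_smooth_bump] by simp
  qed
  ultimately have "integral {0..2*pi} ?g' = 0"
    using LIMSEQ_unique[of "\<lambda>_. 0 :: complex"] by simp
  moreover have "integral {0..2*pi} ?g' = integral {0..2*pi} ?g"
    by (rule integral_spike[OF negN]) auto
  moreover have "integral {0..2*pi} ?g = integral {\<alpha>..\<beta>} h"
    using ab Henstock_Kurzweil_Integration.integral_restrict_Int[of "{0..2*pi}" "{\<alpha>..\<beta>}" h]
    by (auto simp: Int_absorb1)
  ultimately show "integral {\<alpha>..\<beta>} h = 0" by simp
qed


section \<open>Weak derivatives\<close>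

lemma integral_cong_AE_on:
  fixes f g :: "real \<Rightarrow> 'a::banach"
  assumes "AE x in lebesgue. x \<in> S \<longrightarrow> f x = g x"
  shows "integral S f = integral S g"
proof -
  obtain N where N: "N \<in> null_sets lebesgue" "{x \<in> space lebesgue. \<not> (x \<in> S \<longrightarrow> f x = g x)} \<subseteq> N"
    using assms unfolding eventually_ae_filter by blast
  have "negligible N" using N by (simp add: negligible_iff_null_sets)
  then show ?thesis by (rule integral_spike) (use N(2) in auto)
qed

lemma AE_on: "torus_eq f g \<Longrightarrow> AE x in lebesgue. x \<in> S \<longrightarrow> f x = g x"
  unfolding torus_eq_def by (rule AE_mp[where P = "\<lambda>x. f x = g x"]) (simp_all add: AE_I2)

lemma test_function_integrable:
  assumes "f absolutely_integrable_on {0..2*pi}" "torus_smooth \<phi>"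
  shows "(\<lambda>x. f x * \<phi> x) absolutely_integrable_on {0..2*pi}"
    and "(\<lambda>x. f x * vector_derivative \<phi> (at x)) absolutely_integrable_on {0..2*pi}"
  using torus_smooth_derivative(2,3)[OF assms(2)]
  by (auto intro!: continuous_on_imp_mult_absolutely_integrable(2)[OF _ assms(1)] intro: continuous_on_subset)

text \<open>The boundary term is kept because it vanishes for two different reasons: v is periodic
  when a primitive is shown to have a weak derivative, and w has integral 0 in the converse
  direction.\<close>

lemma primitive_test_function:
  assumes w: "w absolutely_integrable_on {0..2*pi}" and \<phi>: "torus_smooth \<phi>"
    and v: "\<And>x. x \<in> {0..2*pi} \<Longrightarrow> v x = c + integral {0..x} w"
  shows "integral {0..2*pi} (\<lambda>x. v x * vector_derivative \<phi> (at x)) =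
    (v (2 * pi) - c) * \<phi> 0 - integral {0..2*pi} (\<lambda>x. w x * \<phi> x)"
proof -
  have "(\<lambda>t. vector_derivative \<phi> (at t)) absolutely_integrable_on {0..2*pi}"
    using torus_smooth_derivative(2)[OF \<phi>]
    by (intro absolutely_integrable_continuous_real) (auto intro: continuous_on_subset)
  then have "integral {0..2*pi} (\<lambda>x. v x * vector_derivative \<phi> (at x)) + integral {0..2*pi} (\<lambda>x. w x * \<phi> x) =
      v (2 * pi) * \<phi> (2 * pi) - c * \<phi> 0"
    by (intro integral_by_parts_primitive w v torus_smooth_primitive[OF \<phi>]) auto
  moreover have "\<phi> (2 * pi) = \<phi> 0" using torus_smooth_derivative(4)[OF \<phi>, of 0] by simp
  ultimately show ?thesis by (simp add: algebra_simps)
qed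

lemma is_weak_deriv_primitive:
  assumes w: "w absolutely_integrable_on {0..2*pi}"
    and v: "\<And>x. x \<in> {0..2*pi} \<Longrightarrow> v x = v 0 + integral {0..x} w" and per: "v (2 * pi) = v 0"
  shows "is_weak_deriv v w"
  unfolding is_weak_deriv_def
proof (intro allI impI)
  fix \<phi> assume \<phi>: "torus_smooth \<phi>"
  have cv: "continuous_on {0..2*pi} v"
    by (rule continuous_on_eq[OF continuous_on_primitive[OF w, of "v 0"] v[symmetric]])
  have "(\<lambda>x. v x * vector_derivative \<phi> (at x)) absolutely_integrable_on {0..2*pi}"
    by (rule test_function_integrable(2)[OF absolutely_integrable_continuous_real[OF cv] \<phi>])
  then show "torus_int (\<lambda>x. v x * vector_derivative \<phi> (at x)) = - torus_int (\<lambda>x. w x * \<phi> x)"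
    using primitive_test_function[OF w \<phi>, of v "v 0", OF v] per test_function_integrable(1)[OF w \<phi>]
    by (simp only: torus_int_eq_integral) simp
qed

text \<open>The difference h of v and a primitive of w is orthogonal to all derivatives of test
  functions. Every test function is a derivative plus a constant, so it suffices to make h
  orthogonal to constants as well, which the choice of c does.\<close>

lemma du_Bois_Reymond:
  assumes v: "v absolutely_integrable_on {0..2*pi}" and w: "w absolutely_integrable_on {0..2*pi}"
    and weak: "is_weak_deriv v w"
  obtains c where "AE x in lebesgue. x \<in> {0..2*pi} \<longrightarrow> v x = c + integral {0..x} w"
    "integral {0..2*pi} w = 0"
proof -
  have weakD: "integral {0..2*pi} (\<lambda>x. v x * vector_derivative \<phi> (at x)) = - integral {0..2*pi} (\<lambda>x. w x * \<phi> x)"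
    if "torus_smooth \<phi>" for \<phi>
    using weak that unfolding is_weak_deriv_def
    by (simp add: torus_int_eq_integral test_function_integrable v w)
  \<comment> \<open>Testing with 1 shows that the primitive W returns to its initial value, so it
    can be integrated by parts without boundary term.\<close>
  have w0: "integral {0..2*pi} w = 0"
    using weakD[OF torus_smooth_const[of 1]] by simp
  define W where "W = (\<lambda>x. integral {0..x} w)"
  have cW: "continuous_on {0..2*pi} W" using continuous_on_primitive[OF w, of 0] by (simp add: W_def)
  have W: "W absolutely_integrable_on {0..2*pi}"
    by (rule absolutely_integrable_continuous_real[OF cW])
  \<comment> \<open>The mean of v - W, so that h has mean zero.\<close>
  define c where "c = integral {0..2*pi} (\<lambda>x. v x - W x) / (2 * pi)"
  define h where "h = (\<lambda>x. v x - W x - c)"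
  have vW: "(\<lambda>x. v x - W x) absolutely_integrable_on {0..2*pi}"
    by (intro set_integral_diff v W)
  have h: "h absolutely_integrable_on {0..2*pi}"
    unfolding h_def by (intro set_integral_diff vW) (auto intro: absolutely_integrable_continuous_real)
  have h0: "integral {0..2*pi} h = 0"
    unfolding h_def using set_lebesgue_integral_eq_integral(1)[OF vW]
    by (subst Henstock_Kurzweil_Integration.integral_diff) (auto simp: c_def scaleR_conv_of_real)
  have hd: "integral {0..2*pi} (\<lambda>x. h x * vector_derivative \<phi> (at x)) = 0" if \<phi>: "torus_smooth \<phi>" for \<phi>
  proof -
    note I = set_lebesgue_integral_eq_integral(1)[OF test_function_integrable(2)[OF _ \<phi>]]
    have "integral {0..2*pi} (\<lambda>x. (W x + c) * vector_derivative \<phi> (at x)) = - integral {0..2*pi} (\<lambda>x. w x * \<phi> x)"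
      using primitive_test_function[OF w \<phi>, of "\<lambda>x. W x + c" c] w0 by (simp add: W_def)
    moreover have "integral {0..2*pi} (\<lambda>x. h x * vector_derivative \<phi> (at x)) =
      integral {0..2*pi} (\<lambda>x. v x * vector_derivative \<phi> (at x) - (W x + c) * vector_derivative \<phi> (at x))"
      by (rule Henstock_Kurzweil_Integration.integral_cong) (simp add: h_def algebra_simps)
    moreover have "(\<lambda>x. W x + c) absolutely_integrable_on {0..2*pi}"
      by (intro absolutely_integrable_continuous_real continuous_intros cW)
    ultimately show ?thesis
      using weakD[OF \<phi>] by (simp add: Henstock_Kurzweil_Integration.integral_diff I v)
  qed
  have "integral {0..2*pi} (\<lambda>x. h x * \<psi> x) = 0" if \<psi>: "torus_smooth \<psi>" for \<psi>
  proof -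
    \<comment> \<open>Only test functions of mean zero have a periodic antiderivative; the mean m is
      split off and handled by the mean of h.\<close>
    define m where "m = integral {0..2*pi} \<psi> / (2 * pi)"
    have i\<psi>: "\<psi> absolutely_integrable_on {0..2*pi}"
      using torus_smooth_derivative(3)[OF \<psi>] by (intro absolutely_integrable_continuous_real) (auto intro: continuous_on_subset)
    have "torus_smooth (\<lambda>x. \<psi> x - m)"
    proof -
      obtain D where D: "D 0 = \<psi>" "\<And>n x. (D n has_vector_derivative D (Suc n) x) (at x)"
        using \<psi> by (auto simp: torus_smooth_def)
      have "((\<lambda>x. \<psi> x - m) has_vector_derivative D (Suc 0) x) (at x)" for x
        using has_vector_derivative_diff[OF D(2)[of 0 x] has_vector_derivative_const[of m]] D(1) by simp
      then show ?thesis
        unfolding torus_smooth_def using D(2) torus_smooth_derivative(4)[OF \<psi>]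
        by (intro conjI allI exI[of _ "\<lambda>n. case n of 0 \<Rightarrow> \<lambda>x. \<psi> x - m | Suc k \<Rightarrow> D (Suc k)"]) (auto split: nat.splits)
    qed
    moreover have "integral {0..2*pi} (\<lambda>x. \<psi> x - m) = 0"
      using set_lebesgue_integral_eq_integral(1)[OF i\<psi>]
      by (subst Henstock_Kurzweil_Integration.integral_diff) (auto simp: m_def scaleR_conv_of_real)
    ultimately obtain \<phi> where \<phi>: "torus_smooth \<phi>" "\<And>x. vector_derivative \<phi> (at x) = \<psi> x - m"
      using torus_smooth_antiderivative by metis
    have "integral {0..2*pi} (\<lambda>x. h x * (\<psi> x - m)) = 0"
      using hd[OF \<phi>(1)] unfolding \<phi>(2) .
    moreover have "integral {0..2*pi} (\<lambda>x. h x * (\<psi> x - m)) =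
      integral {0..2*pi} (\<lambda>x. h x * \<psi> x) - integral {0..2*pi} (\<lambda>x. h x * m)"
      unfolding right_diff_distrib
      using set_lebesgue_integral_eq_integral(1)[OF test_function_integrable(1)[OF h \<psi>]]
        set_lebesgue_integral_eq_integral(1)[OF test_function_integrable(1)[OF h torus_smooth_const[of m]]]
      by (rule Henstock_Kurzweil_Integration.integral_diff)
    ultimately show ?thesis using h0 by simp
  qed
  then have "AE x in lebesgue. x \<in> {0..2*pi} \<longrightarrow> h x = 0"
    by (rule orthogonal_to_smooth_imp_AE_zero[OF h])
  then have "AE x in lebesgue. x \<in> {0..2*pi} \<longrightarrow> v x = c + integral {0..x} w"
    by eventually_elim (auto simp: h_def W_def)
  then show ?thesis using that w0 by blast
qed

lemma is_weak_derivD: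
  "is_weak_deriv v w \<Longrightarrow> torus_smooth \<phi> \<Longrightarrow>
    torus_int (\<lambda>x. v x * vector_derivative \<phi> (at x)) = - torus_int (\<lambda>x. w x * \<phi> x)"
  by (simp add: is_weak_deriv_def)

lemma is_weak_deriv_unique:
  assumes "torus_L2 w1" "torus_L2 w2" "is_weak_deriv v w1" "is_weak_deriv v w2"
  shows "torus_eq w1 w2"
proof (rule torus_eqI)
  have i: "w1 absolutely_integrable_on {0..2*pi}" "w2 absolutely_integrable_on {0..2*pi}"
    using assms torus_L2_imp_absolutely_integrable by auto
  have "AE x in lebesgue. x \<in> {0..2*pi} \<longrightarrow> w1 x - w2 x = 0"
  proof (rule orthogonal_to_smooth_imp_AE_zero)
    show "(\<lambda>x. w1 x - w2 x) absolutely_integrable_on {0..2*pi}"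
      by (intro set_integral_diff i)
    fix \<psi> assume \<psi>: "torus_smooth \<psi>"
    have "torus_int (\<lambda>x. w1 x * \<psi> x) = torus_int (\<lambda>x. w2 x * \<psi> x)"
      using is_weak_derivD[OF assms(3) \<psi>] is_weak_derivD[OF assms(4) \<psi>] by simp
    then show "integral {0..2*pi} (\<lambda>x. (w1 x - w2 x) * \<psi> x) = 0"
      unfolding left_diff_distrib
      by (simp add: torus_int_eq_integral test_function_integrable i \<psi>
          Henstock_Kurzweil_Integration.integral_diff set_lebesgue_integral_eq_integral(1))
  qed
  then show "AE x in lebesgue. x \<in> {0..2*pi} \<longrightarrow> w1 x = w2 x"
    by eventually_elim auto
qed (use assms torus_L2_periodic in auto)

section \<open>Calculus of weak derivatives\<close>

lemma is_weak_deriv_cong: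
  assumes "torus_L2 v1" "torus_L2 v2" "torus_L2 w1" "torus_L2 w2"
    and "torus_eq v1 v2" "torus_eq w1 w2" "is_weak_deriv v1 w1"
  shows "is_weak_deriv v2 w2"
  unfolding is_weak_deriv_def
proof (intro allI impI)
  fix \<phi> assume \<phi>: "torus_smooth \<phi>"
  note i = test_function_integrable[OF torus_L2_imp_absolutely_integrable \<phi>]
  have "integral {0..2*pi} (\<lambda>x. v1 x * vector_derivative \<phi> (at x)) = integral {0..2*pi} (\<lambda>x. v2 x * vector_derivative \<phi> (at x))"
    by (rule integral_cong_AE_on, use AE_on[OF assms(5), of "{0..2*pi}"] in eventually_elim) simp
  moreover have "integral {0..2*pi} (\<lambda>x. w1 x * \<phi> x) = integral {0..2*pi} (\<lambda>x. w2 x * \<phi> x)"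
    by (rule integral_cong_AE_on, use AE_on[OF assms(6), of "{0..2*pi}"] in eventually_elim) simp
  moreover have "torus_int (\<lambda>x. v1 x * vector_derivative \<phi> (at x)) = - torus_int (\<lambda>x. w1 x * \<phi> x)"
    by (rule is_weak_derivD[OF assms(7) \<phi>])
  ultimately show "torus_int (\<lambda>x. v2 x * vector_derivative \<phi> (at x)) = - torus_int (\<lambda>x. w2 x * \<phi> x)"
    using assms by (simp add: torus_int_eq_integral i)
qed

lemma is_weak_deriv_diff:
  assumes "torus_L2 v1" "torus_L2 v2" "torus_L2 w1" "torus_L2 w2" "is_weak_deriv v1 w1" "is_weak_deriv v2 w2"
  shows "is_weak_deriv (\<lambda>x. v1 x - v2 x) (\<lambda>x. w1 x - w2 x)"
  unfolding is_weak_deriv_def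
proof (intro allI impI)
  fix \<phi> assume \<phi>: "torus_smooth \<phi>"
  note i = test_function_integrable[OF torus_L2_imp_absolutely_integrable \<phi>]
  show "torus_int (\<lambda>x. (v1 x - v2 x) * vector_derivative \<phi> (at x)) = - torus_int (\<lambda>x. (w1 x - w2 x) * \<phi> x)"
    unfolding left_diff_distrib using assms \<phi>
    by (simp add: torus_int_diff i is_weak_derivD)
qed

lemma torus_int_cnj: "torus_int (\<lambda>x. cnj (f x)) = cnj (torus_int f)"
proof -
  have "torus_int (\<lambda>x. cnj (f x)) = (\<integral>x. cnj (indicator {0..2*pi} x *\<^sub>R f x) \<partial>lebesgue)"
    unfolding torus_int_def set_lebesgue_integral_def by simp
  also have "\<dots> = cnj (torus_int f)"
    unfolding torus_int_def set_lebesgue_integral_def by (rule Bochner_Integration.integral_cnj)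
  finally show ?thesis .
qed

lemma torus_int_of_real: "torus_int (\<lambda>x. complex_of_real (f x)) = of_real (torus_int f)"
proof -
  have "torus_int (\<lambda>x. complex_of_real (f x)) = (\<integral>x. complex_of_real (indicator {0..2*pi} x *\<^sub>R f x) \<partial>lebesgue)"
    unfolding torus_int_def set_lebesgue_integral_def
    by (intro Bochner_Integration.integral_cong) (auto simp: scaleR_conv_of_real)
  also have "\<dots> = of_real (torus_int f)"
    unfolding torus_int_def set_lebesgue_integral_def by (rule integral_complex_of_real)
  finally show ?thesis .
qed

text \<open>\<open>is_weak_deriv\<close> pairs without conjugation, so the conjugate has to be moved
  onto the test function, and test functions are closed under it.\<close>

lemma is_weak_deriv_cnj:
  assumes "is_weak_deriv v w"
  shows "is_weak_deriv (\<lambda>x. cnj (v x)) (\<lambda>x. cnj (w x))"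
  unfolding is_weak_deriv_def
proof (intro allI impI)
  fix \<phi> assume \<phi>: "torus_smooth \<phi>"
  then obtain D where D: "D 0 = \<phi>" "\<And>n x. (D n has_vector_derivative D (Suc n) x) (at x)"
    by (auto simp: torus_smooth_def)
  have sm: "torus_smooth (\<lambda>x. cnj (\<phi> x))"
    unfolding torus_smooth_def using D torus_smooth_derivative(4)[OF \<phi>]
    by (intro conjI allI exI[of _ "\<lambda>n x. cnj (D n x)"]) (auto intro: has_vector_derivative_cnj)
  have vd: "vector_derivative (\<lambda>x. cnj (\<phi> x)) (at x) = cnj (vector_derivative \<phi> (at x))" for x
    using torus_smooth_derivative(1)[OF \<phi>, of x]
    by (auto intro!: vector_derivative_at has_vector_derivative_cnj)
  have "torus_int (\<lambda>x. v x * cnj (vector_derivative \<phi> (at x))) = - torus_int (\<lambda>x. w x * cnj (\<phi> x))"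
    using is_weak_derivD[OF assms sm] unfolding vd .
  then have "torus_int (\<lambda>x. cnj (v x * cnj (vector_derivative \<phi> (at x)))) = - torus_int (\<lambda>x. cnj (w x * cnj (\<phi> x)))"
    unfolding torus_int_cnj by simp
  then show "torus_int (\<lambda>x. cnj (v x) * vector_derivative \<phi> (at x)) = - torus_int (\<lambda>x. cnj (w x) * \<phi> x)"
    by simp
qed

text \<open>Here u is not a test function, so the definition of the weak derivative does not apply.
  Both factors are replaced by primitives almost everywhere; the primitives take equal values at 0
  and 2 pi, so the boundary terms cancel.\<close>

lemma weak_integration_by_parts:
  assumes L2: "torus_L2 v" "torus_L2 v'" "torus_L2 u" "torus_L2 u'"
    and weak: "is_weak_deriv v v'" "is_weak_deriv u u'"
  shows "torus_int (\<lambda>x. v x * u' x) = - torus_int (\<lambda>x. v' x * u x)"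
proof -
  note i = torus_L2_imp_absolutely_integrable
  obtain c where c: "AE x in lebesgue. x \<in> {0..2*pi} \<longrightarrow> v x = c + integral {0..x} v'" "integral {0..2*pi} v' = 0"
    using du_Bois_Reymond[OF i[OF L2(1)] i[OF L2(2)] weak(1)] by blast
  obtain d where d: "AE x in lebesgue. x \<in> {0..2*pi} \<longrightarrow> u x = d + integral {0..x} u'" "integral {0..2*pi} u' = 0"
    using du_Bois_Reymond[OF i[OF L2(3)] i[OF L2(4)] weak(2)] by blast
  have "integral {0..2*pi} (\<lambda>x. v x * u' x) = integral {0..2*pi} (\<lambda>x. (c + integral {0..x} v') * u' x)"
    by (rule integral_cong_AE_on, use c(1) in eventually_elim) simp
  moreover have "integral {0..2*pi} (\<lambda>x. v' x * u x) = integral {0..2*pi} (\<lambda>x. v' x * (d + integral {0..x} u'))"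
    by (rule integral_cong_AE_on, use d(1) in eventually_elim) simp
  moreover have "integral {0..2*pi} (\<lambda>x. (c + integral {0..x} v') * u' x) +
      integral {0..2*pi} (\<lambda>x. v' x * (d + integral {0..x} u')) = 0"
    using integral_by_parts_primitive[OF _ i[OF L2(2)] i[OF L2(4)], of "\<lambda>x. c + integral {0..x} v'" c "\<lambda>x. d + integral {0..x} u'" d]
      c(2) d(2) by simp
  ultimately show ?thesis
    using L2 by (simp add: torus_int_eq_integral torus_L2_mult_integrable eq_neg_iff_add_eq_0)
qed

section \<open>Sobolev functions\<close>

lemma torus_H1_L2: "torus_H1 v \<Longrightarrow> torus_L2 v"
  by (simp add: torus_H1_def)

lemma wderiv:
  assumes "torus_H1 v"
  shows "torus_L2 (wderiv v)" "is_weak_deriv v (wderiv v)"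
  using someI_ex[of "\<lambda>w. torus_L2 w \<and> is_weak_deriv v w"] assms
  by (auto simp: torus_H1_def wderiv_def)

lemma wderiv_unique:
  assumes "torus_L2 v" "torus_L2 w" "is_weak_deriv v w"
  shows "torus_H1 v" "torus_eq (wderiv v) w"
proof -
  show *: "torus_H1 v" using assms by (auto simp: torus_H1_def)
  show "torus_eq (wderiv v) w"
    using is_weak_deriv_unique[OF wderiv(1)[OF *] assms(2) wderiv(2)[OF *] assms(3)] .
qed

lemma torus_H2_L2:
  assumes "torus_H2 v"
  shows "torus_L2 v" "torus_L2 (wderiv v)" "torus_L2 (wderiv (wderiv v))"
    "is_weak_deriv v (wderiv v)" "is_weak_deriv (wderiv v) (wderiv (wderiv v))" "torus_H1 v"
  using assms wderiv torus_H1_L2 by (auto simp: torus_H2_def)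

lemma torus_eq_refl [simp]: "torus_eq f f"
  by (simp add: torus_eq_def)

text \<open>\<open>torus_H2\<close> is stated through the chosen \<open>wderiv v\<close>, which
  agrees with a known derivative p only almost everywhere; the weak derivative of p has to be
  carried over to it.\<close>

lemma torus_H2_I:
  assumes "torus_L2 v" "torus_L2 p" "torus_L2 w" "is_weak_deriv v p" "is_weak_deriv p w"
  shows "torus_H2 v" "torus_eq (wderiv (wderiv v)) w" "torus_eq (wderiv v) p"
proof -
  note 1 = wderiv_unique[OF assms(1,2,4)]
  have "torus_eq p (wderiv v)" using 1(2) by (auto simp: torus_eq_def eq_commute)
  then have "is_weak_deriv (wderiv v) w"
    by (intro is_weak_deriv_cong[OF assms(2) wderiv(1)[OF 1(1)] assms(3,3) _ _ assms(5)]) auto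
  note 2 = wderiv_unique[OF wderiv(1)[OF 1(1)] assms(3) this]
  show "torus_H2 v" "torus_eq (wderiv (wderiv v)) w" "torus_eq (wderiv v) p"
    using 1 2 by (auto simp: torus_H2_def)
qed

lemma torus_H2_diff:
  assumes "torus_H2 v" "torus_H2 w"
  shows "torus_H2 (\<lambda>x. v x - w x)"
    "torus_eq (wderiv (wderiv (\<lambda>x. v x - w x))) (\<lambda>x. wderiv (wderiv v) x - wderiv (wderiv w) x)"
proof -
  note L2 = torus_H2_L2[OF assms(1)] torus_H2_L2[OF assms(2)]
  note * = torus_H2_I[OF torus_L2_diff torus_L2_diff torus_L2_diff is_weak_deriv_diff is_weak_deriv_diff]
  show "torus_H2 (\<lambda>x. v x - w x)"
    by (rule *(1)) (rule L2)+
  show "torus_eq (wderiv (wderiv (\<lambda>x. v x - w x))) (\<lambda>x. wderiv (wderiv v) x - wderiv (wderiv w) x)"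
    by (rule *(2)) (rule L2)+
qed

lemma energy_identity:
  assumes "torus_H2 v"
  shows "torus_int (\<lambda>x. wderiv (wderiv v) x * cnj (v x)) = - of_real ((L2_norm (wderiv v))\<^sup>2)"
proof -
  note L2 = torus_H2_L2[OF assms]
  have "torus_int (\<lambda>x. wderiv v x * cnj (wderiv v x)) = - torus_int (\<lambda>x. wderiv (wderiv v) x * cnj (v x))"
    by (rule weak_integration_by_parts[OF L2(2,3) torus_L2_cnj[OF L2(1)] torus_L2_cnj[OF L2(2)] L2(5)
          is_weak_deriv_cnj[OF L2(4)]])
  moreover have "torus_int (\<lambda>x. wderiv v x * cnj (wderiv v x)) = of_real ((L2_norm (wderiv v))\<^sup>2)"
    unfolding L2_norm_square by (simp only: complex_norm_square[symmetric] torus_int_of_real)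
  ultimately show ?thesis by (metis neg_equal_iff_equal minus_minus)
qed

section \<open>Bounded coefficients and the damping form\<close>

lemma torus_Linf_bound:
  assumes "torus_Linf a"
  shows "AE x in lebesgue. \<bar>a x\<bar> \<le> Linf_norm a" "0 \<le> Linf_norm a"
proof -
  let ?e = "esssup lebesgue (\<lambda>x. ereal \<bar>a x\<bar>)"
  have ae: "AE x in lebesgue. ereal \<bar>a x\<bar> \<le> ?e" by (rule esssup_AE)
  \<comment> \<open>\<open>real_of_ereal\<close> sends both infinities to 0, so both must be
    excluded before \<open>Linf_norm a\<close> is a bound. A negative essential supremum would make
    the whole line a null set.\<close>
  have "\<not> (AE x::real in lebesgue. False)"
    by (simp add: eventually_False ae_filter_eq_bot_iff)
  then have "0 \<le> ?e"
  proof (rule contrapos_np)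
    assume "\<not> 0 \<le> ?e"
    then have "\<not> ereal \<bar>a x\<bar> \<le> ?e" for x using order_trans[of 0 "ereal \<bar>a x\<bar>" ?e] by auto
    then show "AE x::real in lebesgue. False" using ae by simp
  qed
  moreover have "?e < \<infinity>" using assms by (simp add: torus_Linf_def)
  ultimately have e: "?e = ereal (Linf_norm a)" "0 \<le> Linf_norm a"
    unfolding Linf_norm_def by (cases ?e; auto)+
  show "AE x in lebesgue. \<bar>a x\<bar> \<le> Linf_norm a" using ae by (simp add: e(1))
  show "0 \<le> Linf_norm a" by (fact e(2))
qed

lemma torus_Linf_mult_L2:
  assumes "torus_Linf a" "torus_L2 v"
  shows "torus_L2 (\<lambda>x. of_real (a x) * v x)"
proof (rule torus_L2_bounded_mult[OF _ _ assms(2)])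
  have [measurable]: "a \<in> borel_measurable lebesgue" using assms by (auto simp: torus_Linf_def torus_fun_def)
  show "torus_fun (\<lambda>x. complex_of_real (a x))" using assms by (auto simp: torus_Linf_def torus_fun_def)
  show "AE x in lebesgue. cmod (of_real (a x)) \<le> Linf_norm a" using torus_Linf_bound(1)[OF assms(1)] by simp
qed

lemma absolutely_integrable_complex_of_real:
  "(\<lambda>x. complex_of_real (f x)) absolutely_integrable_on S \<longleftrightarrow> f absolutely_integrable_on S"
proof -
  have 1: "(\<lambda>x. indicator S x *\<^sub>R complex_of_real (f x)) = (\<lambda>x. complex_of_real (indicator S x *\<^sub>R f x))"
    by (simp add: scaleR_conv_of_real)
  have 2: "integrable lebesgue (\<lambda>x. complex_of_real (h x)) \<longleftrightarrow> integrable lebesgue h" for h :: "'a \<Rightarrow> real"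
    using integrable_Re[of lebesgue "\<lambda>x. complex_of_real (h x)"] by auto
  show ?thesis unfolding set_integrable_def 1 2 ..
qed

lemma torus_Linf_quadratic_integrable:
  assumes "torus_Linf a" "torus_L2 v"
  shows "(\<lambda>x. a x * (cmod (v x))\<^sup>2) absolutely_integrable_on {0..2*pi}"
proof -
  have "(\<lambda>x. of_real (a x) * v x * cnj (v x)) absolutely_integrable_on {0..2*pi}"
    by (intro torus_L2_mult_integrable torus_Linf_mult_L2 torus_L2_cnj assms)
  then have "(\<lambda>x. complex_of_real (a x * (cmod (v x))\<^sup>2)) absolutely_integrable_on {0..2*pi}"
    by (simp only: of_real_mult complex_norm_square mult.assoc)
  then show ?thesis by (simp only: absolutely_integrable_complex_of_real)
qed

definition damping :: "(real \<Rightarrow> real) \<Rightarrow> (real \<Rightarrow> complex) \<Rightarrow> real" where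
  "damping a v = torus_int (\<lambda>x. a x * (cmod (v x))\<^sup>2)"

lemma damping_bounds:
  assumes a: "torus_Linf a" "AE x in lebesgue. 0 \<le> a x" and v: "torus_L2 v"
  shows "0 \<le> damping a v" "damping a v \<le> Linf_norm a * (L2_norm v)\<^sup>2"
proof -
  show "0 \<le> damping a v"
    unfolding damping_def torus_int_def set_lebesgue_integral_def
    by (rule integral_nonneg_AE, use a(2) in eventually_elim) simp
  have "damping a v \<le> torus_int (\<lambda>x. Linf_norm a * (cmod (v x))\<^sup>2)"
    unfolding damping_def torus_int_def set_lebesgue_integral_def
  proof (rule integral_mono_AE)
    show "integrable lebesgue (\<lambda>x. indicator {0..2*pi} x *\<^sub>R (a x * (cmod (v x))\<^sup>2))"
      using torus_Linf_quadratic_integrable[OF a(1) v] by (simp only: set_integrable_def)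
    have "set_integrable lebesgue {0..2*pi} (\<lambda>x. Linf_norm a * (cmod (v x))\<^sup>2)"
      by (intro set_integrable_mult_right torus_L2_square v)
    then show "integrable lebesgue (\<lambda>x. indicator {0..2*pi} x *\<^sub>R (Linf_norm a * (cmod (v x))\<^sup>2))"
      by (simp only: set_integrable_def)
    show "AE x in lebesgue. indicator {0..2*pi} x *\<^sub>R (a x * (cmod (v x))\<^sup>2) \<le>
        indicator {0..2*pi} x *\<^sub>R (Linf_norm a * (cmod (v x))\<^sup>2)"
      using torus_Linf_bound(1)[OF a(1)]
      by eventually_elim (auto simp: indicator_def intro: mult_right_mono)
  qed
  then show "damping a v \<le> Linf_norm a * (L2_norm v)\<^sup>2"
    by (simp add: torus_int_mult L2_norm_square)
qed

text \<open>Complex \<alpha> and \<beta> let one identity serve both problems: \<alpha> = - \<mu>,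
  \<beta> = i s for the operator, and \<alpha> = \<sigma>^2 + z^2, \<beta> = z for the damped
  equation.\<close>

lemma energy_identity_potential:
  assumes a: "torus_Linf a" and v: "torus_H2 v"
  shows "torus_int (\<lambda>x. (- wderiv (wderiv v) x + (\<alpha> + \<beta> * of_real (a x)) * v x) * cnj (v x)) =
    of_real ((L2_norm (wderiv v))\<^sup>2) + \<alpha> * of_real ((L2_norm v)\<^sup>2) + \<beta> * of_real (damping a v)"
proof -
  note L2 = torus_H2_L2[OF v]
  let ?w = "\<lambda>x. wderiv (wderiv v) x * cnj (v x)"
  let ?q = "\<lambda>x. complex_of_real ((cmod (v x))\<^sup>2)" and ?p = "\<lambda>x. complex_of_real (a x * (cmod (v x))\<^sup>2)"
  have w: "?w absolutely_integrable_on {0..2*pi}"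
    by (intro torus_L2_mult_integrable L2 torus_L2_cnj)
  have q: "?q absolutely_integrable_on {0..2*pi}" and p: "?p absolutely_integrable_on {0..2*pi}"
    using torus_L2_square[OF L2(1)] torus_Linf_quadratic_integrable[OF a L2(1)]
    by (simp_all only: absolutely_integrable_complex_of_real)
  have eq: "(\<lambda>x. (- wderiv (wderiv v) x + (\<alpha> + \<beta> * of_real (a x)) * v x) * cnj (v x)) =
    (\<lambda>x. (-1) * ?w x + (\<alpha> * ?q x + \<beta> * ?p x))"
    unfolding of_real_mult complex_norm_square by (auto simp: fun_eq_iff algebra_simps)
  have sum: "torus_int (\<lambda>x. (-1) * ?w x + (\<alpha> * ?q x + \<beta> * ?p x)) = - torus_int ?w + (\<alpha> * torus_int ?q + \<beta> * torus_int ?p)"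
  proof -
    have i: "(\<lambda>x. c * ?w x) absolutely_integrable_on {0..2*pi}" "(\<lambda>x. c * ?q x) absolutely_integrable_on {0..2*pi}"
      "(\<lambda>x. c * ?p x) absolutely_integrable_on {0..2*pi}" for c
      using w q p by (intro set_integrable_mult_right; simp only:)+
    show ?thesis
      by (simp only: torus_int_add[OF i(1) set_integral_add(1)[OF i(2,3)]] torus_int_add[OF i(2,3)] torus_int_mult) simp
  qed
  show ?thesis
    unfolding eq sum energy_identity[OF v] torus_int_of_real L2_norm_square damping_def by simp
qed


section \<open>Periodic solutions of \<open>v'' = q v - f\<close>\<close>

text \<open>In the norm sup |h t| exp (- k t), integration from 0 gains a factor 1 / k.\<close>

lemma norm_integral_exp_le:
  fixes h :: "real \<Rightarrow> complex"
  assumes h: "h integrable_on {0..x}" and le: "\<And>t. t \<in> {0..x} \<Longrightarrow> norm (h t) \<le> C * exp (k * t)"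
    and "0 < k" "0 \<le> C" "0 \<le> x"
  shows "norm (integral {0..x} h) \<le> C / k * exp (k * x)"
proof -
  have I: "((\<lambda>t. C * exp (k * t)) has_integral (C / k * exp (k * x) - C / k * exp (k * 0))) {0..x}"
    using assms
    by (intro fundamental_theorem_of_calculus)
      (auto intro!: derivative_eq_intros simp flip: has_real_derivative_iff_has_vector_derivative)
  have "norm (integral {0..x} h) \<le> integral {0..x} (\<lambda>t. C * exp (k * t))"
    using I by (intro Henstock_Kurzweil_Integration.integral_norm_bound_integral h le) auto
  also have "\<dots> = C / k * exp (k * x) - C / k" by (subst integral_unique[OF I]) simp
  also have "\<dots> \<le> C / k * exp (k * x)" using assms by simp
  finally show ?thesis .
qed

lemma bounded_mult_continuous_absolutely_integrable:
  fixes q v :: "real \<Rightarrow> complex"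
  assumes q: "q \<in> borel_measurable lebesgue" "\<And>x. cmod (q x) \<le> Q"
    and v: "continuous_on {a..b} v"
  shows "(\<lambda>x. q x * v x) absolutely_integrable_on {a..b}"
  by (rule absolutely_integrable_bounded_measurable_product[OF bilinear_times])
    (use q in \<open>auto simp: bounded_iff intro: borel_measurable_lebesgue_on absolutely_integrable_continuous_real[OF v]\<close>)

text \<open>The equation v'' = q v - f as a first-order system with p = v', in integral form: q and
  f need not be continuous, so p need not be differentiable everywhere, but the integral equations
  hold at every point.\<close>

definition ode_solution ::
  "real \<Rightarrow> (real \<Rightarrow> complex) \<Rightarrow> (real \<Rightarrow> complex) \<Rightarrow> (real \<Rightarrow> complex) \<Rightarrow> (real \<Rightarrow> complex) \<Rightarrow> bool" where
  "ode_solution b q f v p \<longleftrightarrow> continuous_on {0..b} v \<and> continuous_on {0..b} p \<and>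
    (\<forall>x\<in>{0..b}. v x = v 0 + integral {0..x} p) \<and>
    (\<forall>x\<in>{0..b}. p x = p 0 + integral {0..x} (\<lambda>t. q t * v t - f t))"

text \<open>Weighting the supremum norm with \<open>exp (- k x)\<close>, \<open>k = Q + 1\<close>, makes the Volterra operator a
  contraction on the whole interval.\<close>

lemma ode_solution_exists:
  assumes b: "0 \<le> b" and q: "q \<in> borel_measurable lebesgue" "\<And>x. cmod (q x) \<le> Q"
    and f: "f absolutely_integrable_on {0..b}"
  obtains v p where "ode_solution b q f v p" "v 0 = \<alpha>" "p 0 = \<beta>"
proof -
  define k where "k = Q + 1"
  have Q0: "0 \<le> Q" using q(2)[of 0] norm_ge_zero order_trans by blast
  then have k: "1 \<le> k" by (simp add: k_def)
  \<comment> \<open>The unknown of the fixed point problem is u = exp (- k y) v, so that the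
    ordinary distance of bounded continuous functions is the weighted distance of v.
    \<open>V\<close> removes the weight, and \<open>M\<close> is the Volterra operator in terms of
    u.\<close>
  define V :: "(real \<Rightarrow>\<^sub>C complex) \<Rightarrow> real \<Rightarrow> complex" where "V = (\<lambda>u y. of_real (exp (k * y)) * u y)"
  define P where "P = (\<lambda>u x. \<beta> + integral {0..x} (\<lambda>t. q t * V u t - f t))"
  define M where "M = (\<lambda>u x. of_real (exp (- (k * x))) * (\<alpha> + integral {0..x} (P u)))"
  have cV: "continuous_on S (V u)" for u S
    unfolding V_def by (intro continuous_intros continuous_on_apply_bcontfun)
  have iq: "(\<lambda>t. q t * V u t) absolutely_integrable_on {0..x}" for u x
    by (rule bounded_mult_continuous_absolutely_integrable[OF q cV])
  have iqf: "(\<lambda>t. q t * V u t - f t) absolutely_integrable_on {0..b}" for u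
    by (intro set_integral_diff iq f)
  have cP: "continuous_on {0..b} (P u)" for u
    unfolding P_def by (rule continuous_on_primitive[OF iqf])
  have iP: "P u absolutely_integrable_on {0..b}" for u
    by (rule absolutely_integrable_continuous_real[OF cP])
  have cM: "continuous_on {0..b} (M u)" for u
    unfolding M_def by (intro continuous_on_mult continuous_on_primitive[OF iP] continuous_intros)
  \<comment> \<open>\<open>M u\<close> is under control on [0, b] alone; \<open>clamp\<close>
    extends it by its end values to an element of the complete space.\<close>
  have "\<exists>g :: real \<Rightarrow>\<^sub>C complex. \<forall>x. g x = M u (clamp 0 b x)" for u
    using continuous_on_cbox_bcontfunE[of 0 b "M u"] cM by (metis box_real(2))
  then obtain \<Phi> :: "(real \<Rightarrow>\<^sub>C complex) \<Rightarrow> (real \<Rightarrow>\<^sub>C complex)" where \<Phi>: "\<And>u x. \<Phi> u x = M u (clamp 0 b x)"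
    by metis
  have M_le: "cmod (M u x - M w x) \<le> 1/2 * dist u w" if x: "x \<in> {0..b}" for u w x
  proof -
    define D where "D = dist u w"
    have D0: "0 \<le> D" by (simp add: D_def)
    have VD: "cmod (V u t - V w t) \<le> D * exp (k * t)" for t
    proof -
      have "V u t - V w t = of_real (exp (k * t)) * (u t - w t)" by (simp add: V_def algebra_simps)
      then have "cmod (V u t - V w t) = exp (k * t) * dist (u t) (w t)" by (simp add: norm_mult dist_norm)
      also have "\<dots> \<le> exp (k * t) * D" unfolding D_def by (intro mult_left_mono dist_bounded) auto
      finally show ?thesis by (simp add: mult.commute)
    qed
    have PD: "cmod (P u y - P w y) \<le> Q * D / k * exp (k * y)" if y: "y \<in> {0..b}" for y
    proof -
      note i1 = absolutely_integrable_on_subinterval_real(2)[OF iqf, of 0 y]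
      have "P u y - P w y = integral {0..y} (\<lambda>t. (q t * V u t - f t) - (q t * V w t - f t))"
        unfolding P_def using y i1 by (subst Henstock_Kurzweil_Integration.integral_diff) auto
      also have "\<dots> = integral {0..y} (\<lambda>t. q t * V u t - q t * V w t)"
        by (rule Henstock_Kurzweil_Integration.integral_cong) simp
      also have "cmod \<dots> \<le> Q * D / k * exp (k * y)"
      proof (rule norm_integral_exp_le)
        show "(\<lambda>t. q t * V u t - q t * V w t) integrable_on {0..y}"
          by (intro integrable_diff set_lebesgue_integral_eq_integral(1)[OF iq])
        show "cmod (q t * V u t - q t * V w t) \<le> Q * D * exp (k * t)" for t
          unfolding right_diff_distrib[symmetric] norm_mult mult.assoc
          by (intro mult_mono q VD Q0) auto
      qed (use k Q0 D0 y in auto)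
      finally show ?thesis .
    qed
    note i2 = absolutely_integrable_on_subinterval_real(2)[OF iP, of 0 x]
    have "M u x - M w x = of_real (exp (- (k * x))) * integral {0..x} (\<lambda>t. P u t - P w t)"
      unfolding M_def using x i2 by (subst Henstock_Kurzweil_Integration.integral_diff) (auto simp: algebra_simps)
    then have "cmod (M u x - M w x) = exp (- (k * x)) * cmod (integral {0..x} (\<lambda>t. P u t - P w t))"
      by (simp add: norm_mult)
    also have "\<dots> \<le> exp (- (k * x)) * (Q * D / k / k * exp (k * x))"
    proof (intro mult_left_mono norm_integral_exp_le)
      show "(\<lambda>t. P u t - P w t) integrable_on {0..x}" using x i2 by (intro integrable_diff) auto
      show "cmod (P u t - P w t) \<le> Q * D / k * exp (k * t)" if "t \<in> {0..x}" for t
        using that x by (intro PD) auto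
    qed (use k Q0 D0 x in auto)
    also have "\<dots> = Q / (k * k) * D" by (simp add: exp_minus field_simps)
    \<comment> \<open>A factor Q comes from the coefficient and 1 / k from each of the two
      integrations; k = Q + 1 gives k * k \<ge> 2 * Q.\<close>
    also have "\<dots> \<le> 1/2 * D"
    proof (rule mult_right_mono[OF _ D0])
      have "0 \<le> Q * Q" by simp
      then have "2 * Q \<le> k * k" by (simp add: k_def algebra_simps)
      then show "Q / (k * k) \<le> 1/2" using k by (simp add: divide_le_eq)
    qed
    finally show ?thesis by (simp add: D_def)
  qed
  have "\<exists>!u. \<Phi> u = u"
  proof (rule banach_fix_type[of "1/2"], simp, simp, intro allI dist_bound)
    fix u w x
    have "clamp 0 b x \<in> {0..b}" using clamp_in_interval[of 0 b x] b by simp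
    then show "dist (\<Phi> u x) (\<Phi> w x) \<le> 1/2 * dist u w"
      unfolding \<Phi> dist_norm using M_le by (simp add: dist_norm)
  qed
  then obtain u where u: "\<Phi> u = u" by blast
  have Vx: "V u x = \<alpha> + integral {0..x} (P u)" if "x \<in> {0..b}" for x
  proof -
    have "u x = M u x" using \<Phi>[of u x] u that by simp
    then have "V u x = (of_real (exp (k * x)) * of_real (exp (- (k * x)))) * (\<alpha> + integral {0..x} (P u))"
      unfolding V_def M_def by simp
    also have "of_real (exp (k * x)) * of_real (exp (- (k * x))) = (1 :: complex)"
      by (simp flip: of_real_mult exp_add)
    finally show ?thesis by simp
  qed
  have V0: "V u 0 = \<alpha>" using Vx[of 0] b by simp
  have P0: "P u 0 = \<beta>" by (simp add: P_def)
  have "ode_solution b q f (V u) (P u)"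
    unfolding ode_solution_def V0 P0 using cV cP Vx by (auto simp: P_def)
  then show ?thesis using that V0 P0 by blast
qed

section \<open>Superposition and periodic boundary conditions\<close>

lemma ode_solution_combine:
  assumes q: "q \<in> borel_measurable lebesgue" "\<And>x. cmod (q x) \<le> Q"
    and f: "f absolutely_integrable_on {0..b}" "g absolutely_integrable_on {0..b}"
    and 1: "ode_solution b q f v p" and 2: "ode_solution b q g w r"
  shows "ode_solution b q (\<lambda>x. f x + c * g x) (\<lambda>x. v x + c * w x) (\<lambda>x. p x + c * r x)"
proof -
  have c: "continuous_on {0..b} v" "continuous_on {0..b} p" "continuous_on {0..b} w" "continuous_on {0..b} r"
    using 1 2 by (auto simp: ode_solution_def)
  have I: "integral {0..x} (\<lambda>t. h1 t + c * h2 t) = integral {0..x} h1 + c * integral {0..x} h2"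
    if "h1 absolutely_integrable_on {0..b}" "h2 absolutely_integrable_on {0..b}" "x \<in> {0..b}" for h1 h2 :: "real \<Rightarrow> complex" and x
    using that absolutely_integrable_on_subinterval_real(2)[OF that(1), of 0 x] absolutely_integrable_on_subinterval_real(2)[OF that(2), of 0 x]
    by (subst Henstock_Kurzweil_Integration.integral_add) (auto intro: integrable_on_mult_right)
  have A: "(\<lambda>t. q t * v t - f t) absolutely_integrable_on {0..b}" "(\<lambda>t. q t * w t - g t) absolutely_integrable_on {0..b}"
    by (intro set_integral_diff bounded_mult_continuous_absolutely_integrable[OF q] c f)+
  have eq: "(\<lambda>t. q t * (v t + c * w t) - (f t + c * g t)) = (\<lambda>t. (q t * v t - f t) + c * (q t * w t - g t))"
    by (auto simp: algebra_simps)
  have v: "v x = v 0 + integral {0..x} p" and w: "w x = w 0 + integral {0..x} r"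
    and p: "p x = p 0 + integral {0..x} (\<lambda>t. q t * v t - f t)"
    and r: "r x = r 0 + integral {0..x} (\<lambda>t. q t * w t - g t)" if "x \<in> {0..b}" for x
    using 1 2 that unfolding ode_solution_def by blast+
  show ?thesis
    unfolding ode_solution_def
  proof (intro conjI ballI)
    show "continuous_on {0..b} (\<lambda>x. v x + c * w x)" "continuous_on {0..b} (\<lambda>x. p x + c * r x)"
      by (intro continuous_intros c)+
    fix x assume x: "x \<in> {0..b}"
    show "v x + c * w x = v 0 + c * w 0 + integral {0..x} (\<lambda>x. p x + c * r x)"
      unfolding I[OF absolutely_integrable_continuous_real[OF c(2)] absolutely_integrable_continuous_real[OF c(4)] x]
      using v[OF x] w[OF x] by (simp add: algebra_simps)
    show "p x + c * r x = p 0 + c * r 0 + integral {0..x} (\<lambda>t. q t * (v t + c * w t) - (f t + c * g t))"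
      unfolding eq I[OF A x] using p[OF x] r[OF x] by (simp add: algebra_simps)
  qed
qed

text \<open>Cramer's rule. If the determinant vanished, (d, -c) and (b, -a) would lie in the kernel,
  so all four coefficients would be 0, and (1, 0) would be a nonzero kernel vector.\<close>

lemma linear_system_2:
  fixes a b c d :: "'a::field"
  assumes "\<And>x y. a * x + b * y = 0 \<Longrightarrow> c * x + d * y = 0 \<Longrightarrow> x = 0 \<and> y = 0"
  obtains x y where "a * x + b * y = e" "c * x + d * y = f"
proof -
  have "a * d - b * c \<noteq> 0"
  proof
    assume det: "a * d - b * c = 0"
    have "d = 0 \<and> - c = 0" by (rule assms) (use det in \<open>auto simp: algebra_simps\<close>)
    moreover have "b = 0 \<and> - a = 0" by (rule assms) (use det in \<open>auto simp: algebra_simps\<close>)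
    ultimately show False using assms[of 1 0] by simp
  qed
  then have "(a * (e * d - b * f) + b * (a * f - e * c)) / (a * d - b * c) = e"
    "(c * (e * d - b * f) + d * (a * f - e * c)) / (a * d - b * c) = f"
    by (simp_all add: divide_eq_eq) (simp_all add: algebra_simps)
  then show ?thesis
    by (intro that[of "(e * d - b * f) / (a * d - b * c)" "(a * f - e * c) / (a * d - b * c)"])
      (simp_all add: add_divide_distrib)
qed

text \<open>A shooting argument: a particular solution plus a combination of the two fundamental
  solutions with data (1, 0) and (0, 1). Periodicity is a 2 x 2 system for the coefficients, and a
  kernel vector of it would be a periodic homogeneous solution.\<close>

lemma periodic_ode_solution_exists:
  assumes b: "0 < b" and q: "q \<in> borel_measurable lebesgue" "\<And>x. cmod (q x) \<le> Q"
    and f: "f absolutely_integrable_on {0..b}"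
    and inj: "\<And>v p. ode_solution b q (\<lambda>_. 0) v p \<Longrightarrow> v b = v 0 \<Longrightarrow> p b = p 0 \<Longrightarrow> \<forall>x\<in>{0..b}. v x = 0"
  obtains v p where "ode_solution b q f v p" "v b = v 0" "p b = p 0"
proof -
  have b0: "0 \<le> b" using b by simp
  have z: "(\<lambda>_. 0 :: complex) absolutely_integrable_on {0..b}" by simp
  obtain v1 p1 where 1: "ode_solution b q (\<lambda>_. 0) v1 p1" "v1 0 = 1" "p1 0 = 0"
    by (rule ode_solution_exists[OF b0 q z])
  obtain v2 p2 where 2: "ode_solution b q (\<lambda>_. 0) v2 p2" "v2 0 = 0" "p2 0 = 1"
    by (rule ode_solution_exists[OF b0 q z])
  obtain v0 p0 where 0: "ode_solution b q f v0 p0" "v0 0 = 0" "p0 0 = 0"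
    by (rule ode_solution_exists[OF b0 q f])
  have zero: "ode_solution b q (\<lambda>_. 0) (\<lambda>_. 0) (\<lambda>_. 0)"
    by (simp add: ode_solution_def)
  obtain x y where xy: "(v1 b - 1) * x + v2 b * y = - v0 b" "p1 b * x + (p2 b - 1) * y = - p0 b"
  proof (rule linear_system_2[of "v1 b - 1" "v2 b" "p1 b" "p2 b - 1"])
    fix x y assume xy: "(v1 b - 1) * x + v2 b * y = 0" "p1 b * x + (p2 b - 1) * y = 0"
    let ?v = "\<lambda>t. x * v1 t + y * v2 t" and ?p = "\<lambda>t. x * p1 t + y * p2 t"
    have s: "ode_solution b q (\<lambda>_. 0) ?v ?p"
      using ode_solution_combine[OF q z z ode_solution_combine[OF q z z zero 1(1), of x, simplified] 2(1), of y]
      by simp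
    have "\<forall>t\<in>{0..b}. ?v t = 0"
      by (rule inj[OF s]) (use xy 1 2 in \<open>simp_all add: algebra_simps\<close>)
    then have v: "?v t = 0" if "t \<in> {0..b}" for t using that by blast
    have x: "x = 0" using v[of 0] b 1 2 by simp
    \<comment> \<open>Injectivity speaks of v alone. Since v vanishes, p is constant with value y,
      and then v b = v 0 + y * b forces y = 0.\<close>
    have "?p t = y" if "t \<in> {0..b}" for t
    proof -
      have "?p t = ?p 0 + integral {0..t} (\<lambda>t. q t * ?v t - 0)"
        using s that unfolding ode_solution_def by blast
      also have "integral {0..t} (\<lambda>t. q t * ?v t - 0) = integral {0..t} (\<lambda>t. 0)"
        by (rule Henstock_Kurzweil_Integration.integral_cong) (use v that in auto)
      finally show ?thesis using 1 2 by simp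
    qed
    then have "integral {0..b} ?p = integral {0..b} (\<lambda>_. y)"
      by (intro Henstock_Kurzweil_Integration.integral_cong)
    moreover have "?v b = ?v 0 + integral {0..b} ?p"
      using s b0 unfolding ode_solution_def by (meson atLeastAtMost_iff order_refl)
    ultimately have "y = 0" using v[of 0] v[of b] b by simp
    then show "x = 0 \<and> y = 0" using x by simp
  qed
  let ?v = "\<lambda>t. v0 t + x * v1 t + y * v2 t" and ?p = "\<lambda>t. p0 t + x * p1 t + y * p2 t"
  have "ode_solution b q f ?v ?p"
    using ode_solution_combine[OF q f z ode_solution_combine[OF q f z 0(1) 1(1), of x, simplified] 2(1), of y]
    by simp
  moreover have "?v b = ?v 0" "?p b = ?p 0"
    using xy 0 1 2 by (simp_all add: algebra_simps eq_neg_iff_add_eq_0)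
  ultimately show ?thesis using that by blast
qed

lemma periodic_extension:
  assumes h: "continuous_on {0..2*pi} h" and per: "h (2 * pi) = h 0"
  obtains H where "torus_L2 H" "\<And>x. x \<in> {0..2*pi} \<Longrightarrow> H x = h x"
proof -
  define m where "m = (\<lambda>x. x - 2 * pi * of_int \<lfloor>x / (2 * pi)\<rfloor>)"
  have m: "m x \<in> {0..2*pi}" for x
  proof -
    define k where "k = \<lfloor>x / (2 * pi)\<rfloor>"
    have "of_int k \<le> x / (2 * pi)" "x / (2 * pi) < of_int k + 1"
      unfolding k_def by linarith+
    then have "2 * pi * of_int k \<le> x" "x < 2 * pi * of_int k + 2 * pi"
      by (simp_all add: field_simps)
    then show ?thesis by (auto simp: m_def k_def)
  qed
  \<comment> \<open>Composing a bounded continuous extension of h with the discontinuous reduction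
    \<open>m\<close> gives Borel measurability and the bound for L2 at once.\<close>
  obtain g :: "real \<Rightarrow>\<^sub>C complex" where g: "\<And>x. x \<in> {0..2*pi} \<Longrightarrow> g x = h x"
    using continuous_on_cbox_bcontfunE[of 0 "2*pi" h] h by (metis box_real(2))
  define H where "H = (\<lambda>x. g (m x))"
  have Hper: "H (x + 2 * pi) = H x" for x
  proof -
    have "(x + 2 * pi) / (2 * pi) = x / (2 * pi) + 1" by (simp add: field_simps)
    then show ?thesis by (simp add: H_def m_def algebra_simps)
  qed
  have "m \<in> borel_measurable borel" unfolding m_def by measurable
  then have "H \<in> borel_measurable borel"
    unfolding H_def by (rule borel_measurable_continuous_on[OF continuous_on_apply_bcontfun])
  then have "H \<in> borel_measurable lebesgue" by (auto intro: measurable_completion)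
  then have Hfun: "torus_fun H" using Hper by (simp add: torus_fun_def)
  have "torus_L2 H"
    by (rule torus_L2_dominated[OF Hfun torus_L2_const[of 1] torus_L2_const[of 0], of "norm g"])
      (auto simp: H_def norm_bounded)
  moreover have "H x = h x" if "x \<in> {0..2*pi}" for x
  proof (cases "x = 2 * pi")
    \<comment> \<open>The right end is reduced to 0, so the values agree only because h is
      periodic.\<close>
    case True
    then show ?thesis using per g[of 0] by (simp add: H_def m_def)
  next
    case False
    then have "x / (2 * pi) < 1" "0 \<le> x / (2 * pi)" using that by auto
    then have "\<lfloor>x / (2 * pi)\<rfloor> = 0" by (simp add: floor_eq_iff)
    then show ?thesis using g[OF that] by (simp add: H_def m_def)
  qed
  ultimately show ?thesis using that by blast
qed

lemma periodic_ode_solution_torus_H2: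
  assumes q: "torus_fun q" "\<And>x. cmod (q x) \<le> Q" and f: "torus_L2 f"
    and ode: "ode_solution (2 * pi) q f v p" and per: "v (2 * pi) = v 0" "p (2 * pi) = p 0"
  obtains V where "torus_H2 V" "\<And>x. x \<in> {0..2*pi} \<Longrightarrow> V x = v x"
    "torus_eq (\<lambda>x. - wderiv (wderiv V) x + q x * V x) f"
proof -
  have cont: "continuous_on {0..2*pi} v" "continuous_on {0..2*pi} p"
    and v: "\<And>x. x \<in> {0..2*pi} \<Longrightarrow> v x = v 0 + integral {0..x} p"
    and p: "\<And>x. x \<in> {0..2*pi} \<Longrightarrow> p x = p 0 + integral {0..x} (\<lambda>t. q t * v t - f t)"
    using ode unfolding ode_solution_def by blast+
  obtain V where V: "torus_L2 V" "\<And>x. x \<in> {0..2*pi} \<Longrightarrow> V x = v x"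
    using periodic_extension[OF cont(1) per(1)] by blast
  obtain P where P: "torus_L2 P" "\<And>x. x \<in> {0..2*pi} \<Longrightarrow> P x = p x"
    using periodic_extension[OF cont(2) per(2)] by blast
  let ?w = "\<lambda>x. q x * V x - f x"
  have w: "torus_L2 ?w"
    by (intro torus_L2_diff f torus_L2_bounded_mult[where M = Q, OF q(1) _ V(1)]) (use q(2) in simp)
  have wV: "is_weak_deriv V P"
  proof (rule is_weak_deriv_primitive[OF torus_L2_imp_absolutely_integrable[OF P(1)]])
    show "V x = V 0 + integral {0..x} P" if x: "x \<in> {0..2*pi}" for x
    proof -
      have "integral {0..x} P = integral {0..x} p"
        by (rule Henstock_Kurzweil_Integration.integral_cong) (use P(2) x in auto)
      then show ?thesis using V(2)[OF x] V(2)[of 0] v[OF x] by simp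
    qed
    show "V (2 * pi) = V 0" using V(2)[of 0] V(2)[of "2*pi"] per by simp
  qed
  have wP: "is_weak_deriv P ?w"
  proof (rule is_weak_deriv_primitive[OF torus_L2_imp_absolutely_integrable[OF w]])
    show "P x = P 0 + integral {0..x} ?w" if x: "x \<in> {0..2*pi}" for x
    proof -
      have "integral {0..x} ?w = integral {0..x} (\<lambda>t. q t * v t - f t)"
        by (rule Henstock_Kurzweil_Integration.integral_cong) (use V(2) x in auto)
      then show ?thesis using P(2)[OF x] P(2)[of 0] p[OF x] by simp
    qed
    show "P (2 * pi) = P 0" using P(2)[of 0] P(2)[of "2*pi"] per by simp
  qed
  note H2 = torus_H2_I[OF V(1) P(1) w wV wP]
  have "torus_eq (\<lambda>x. - wderiv (wderiv V) x + q x * V x) f"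
    using H2(2) unfolding torus_eq_def by eventually_elim simp
  then show ?thesis using that H2(1) V(2) by blast
qed

text \<open>The Fredholm alternative in one dimension: uniqueness gives existence, since the
  obstruction is a 2 x 2 determinant.\<close>

lemma Schroedinger_solvable:
  assumes q: "torus_fun q" "AE x in lebesgue. cmod (q x) \<le> Q" "0 \<le> Q" and f: "torus_L2 f"
    and inj: "\<And>v. torus_H2 v \<Longrightarrow> torus_eq (\<lambda>x. - wderiv (wderiv v) x + q x * v x) (\<lambda>_. 0) \<Longrightarrow> torus_eq v (\<lambda>_. 0)"
  obtains v where "torus_H2 v" "torus_eq (\<lambda>x. - wderiv (wderiv v) x + q x * v x) f"
proof -
  \<comment> \<open>The contraction argument needs a bound on q at every point, not almost
    everywhere; truncation changes q on a null set.\<close>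
  define q' where "q' = (\<lambda>x. if cmod (q x) \<le> Q then q x else 0)"
  have [measurable]: "q \<in> borel_measurable lebesgue" using q by (simp add: torus_fun_def)
  have "q' \<in> borel_measurable lebesgue" unfolding q'_def by measurable
  then have q': "torus_fun q'" "\<And>x. cmod (q' x) \<le> Q" "q' \<in> borel_measurable lebesgue"
    using q by (auto simp: torus_fun_def q'_def)
  have qq': "torus_eq q' q"
    unfolding torus_eq_def using q(2) by eventually_elim (simp add: q'_def)
  have transfer: "torus_eq (\<lambda>x. - wderiv (wderiv v) x + q x * v x) g"
    if "torus_eq (\<lambda>x. - wderiv (wderiv v) x + q' x * v x) g" for v g
    using that qq' unfolding torus_eq_def by eventually_elim simp
  have "\<forall>x\<in>{0..2*pi}. v x = 0"
    if ode: "ode_solution (2*pi) q' (\<lambda>_. 0) v p" and per: "v (2*pi) = v 0" "p (2*pi) = p 0" for v p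
  proof -
    obtain V where V: "torus_H2 V" "\<And>x. x \<in> {0..2*pi} \<Longrightarrow> V x = v x"
      "torus_eq (\<lambda>x. - wderiv (wderiv V) x + q' x * V x) (\<lambda>_. 0)"
      using periodic_ode_solution_torus_H2[OF q'(1,2) torus_L2_const ode per] by blast
    have "torus_eq V (\<lambda>_. 0)" using inj[OF V(1) transfer[OF V(3)]] .
    \<comment> \<open>From almost everywhere to everywhere: |v| is continuous and nonnegative with
      integral 0.\<close>
    then have "AE x in lebesgue. x \<in> {0..2*pi} \<longrightarrow> cmod (v x) = 0"
      unfolding torus_eq_def by eventually_elim (metis V(2) norm_zero)
    then have "integral {0..2*pi} (\<lambda>x. cmod (v x)) = integral {0..2*pi} (\<lambda>x. 0 :: real)"
      by (rule integral_cong_AE_on)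
    moreover have "continuous_on {0..2*pi} (\<lambda>x. cmod (v x))"
      using ode by (intro continuous_on_norm) (simp add: ode_solution_def)
    ultimately show ?thesis
      using integral_eq_0_iff[of 0 "2*pi" "\<lambda>x. cmod (v x)"] by simp
  qed
  then obtain v p where vp: "ode_solution (2*pi) q' f v p" "v (2*pi) = v 0" "p (2*pi) = p 0"
    using periodic_ode_solution_exists[OF _ q'(3,2) torus_L2_imp_absolutely_integrable[OF f]]
    by (metis pi_gt_zero zero_less_mult_iff zero_less_numeral)
  then obtain V where "torus_H2 V" "torus_eq (\<lambda>x. - wderiv (wderiv V) x + q' x * V x) f"
    using periodic_ode_solution_torus_H2[OF q'(1,2) f vp] by blast
  then show ?thesis using that transfer by blast
qed


section \<open>Eigenfunctions and the spectrum\<close>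

lemma torus_int_eq_0: "torus_eq f (\<lambda>_. 0) \<Longrightarrow> torus_int (\<lambda>x. f x * g x) = (0 :: complex)"
  unfolding torus_int_def set_lebesgue_integral_def torus_eq_def
  by (rule integral_eq_zero_AE, erule eventually_mono) simp

lemma poincare_constantD:
  assumes "poincare_constant C" "torus_Linf a" "AE x in lebesgue. 0 \<le> a x"
    and "0 < r" "r \<le> pi" "0 < Theta a r" "torus_H1 v"
  shows "(L2_norm v)\<^sup>2 \<le> C * (inverse (Theta a r) * damping a v + r\<^sup>2 * (L2_norm (wderiv v))\<^sup>2)"
  using assms unfolding poincare_constant_def damping_def by blast

text \<open>\<open>poincare_constant C\<close> does not state a sign for C. For C \<le> 0 its
  right-hand side would be nonpositive, while a nonzero v has positive norm.\<close>

lemma poincare_constant_pos: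
  assumes C: "poincare_constant C" and a: "torus_Linf a" "AE x in lebesgue. 0 \<le> a x"
    and r: "0 < r" "r \<le> pi" "0 < Theta a r"
    and v: "torus_H1 v" "\<not> torus_eq v (\<lambda>_. 0)"
  shows "0 < C"
proof (rule ccontr)
  assume "\<not> 0 < C"
  have L2: "torus_L2 v" by (rule torus_H1_L2[OF v(1)])
  have "0 \<le> inverse (Theta a r) * damping a v + r\<^sup>2 * (L2_norm (wderiv v))\<^sup>2"
    using r damping_bounds(1)[OF a L2] by simp
  then have "C * (inverse (Theta a r) * damping a v + r\<^sup>2 * (L2_norm (wderiv v))\<^sup>2) \<le> 0"
    using \<open>\<not> 0 < C\<close> by (intro mult_nonpos_nonneg) auto
  then have "(L2_norm v)\<^sup>2 \<le> 0" using poincare_constantD[OF C a r v(1)] by linarith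
  then show False using L2_norm_pos[OF L2 v(2)] by simp
qed

text \<open>Supplies a nonzero function to deduce 0 < C in the spectral statement, where no
  eigenfunction is at hand.\<close>

lemma torus_one: "torus_H1 (\<lambda>_. 1)" "\<not> torus_eq (\<lambda>_. 1 :: complex) (\<lambda>_. 0)"
proof -
  have "is_weak_deriv (\<lambda>_. 1) (\<lambda>_. 0)"
    by (rule is_weak_deriv_primitive) auto
  then show "torus_H1 (\<lambda>_. 1)" using wderiv_unique(1) torus_L2_const by blast
  show "\<not> torus_eq (\<lambda>_. 1 :: complex) (\<lambda>_. 0)"
    by (simp add: torus_eq_def eventually_False ae_filter_eq_bot_iff)
qed

lemma quadratic_eigen_identity:
  assumes a: "torus_Linf a" and v: "torus_H2 v"
    and eq: "torus_eq (\<lambda>x. - wderiv (wderiv v) x + (\<alpha> + \<beta> * of_real (a x)) * v x) (\<lambda>_. 0)"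
  shows "of_real ((L2_norm (wderiv v))\<^sup>2) + \<alpha> * of_real ((L2_norm v)\<^sup>2) + \<beta> * of_real (damping a v) = 0"
  unfolding energy_identity_potential[OF a v, symmetric] by (rule torus_int_eq_0[OF eq])

lemma eigenvalue_identities:
  assumes a: "torus_Linf a" and v: "torus_H2 v" "\<not> torus_eq v (\<lambda>_. 0)"
    and eq: "torus_eq (T_op a s v) (\<lambda>x. \<mu> * v x)"
  shows "Re \<mu> = (L2_norm (wderiv v))\<^sup>2 / (L2_norm v)\<^sup>2" "Im \<mu> = s * (damping a v / (L2_norm v)\<^sup>2)"
proof -
  have N: "0 < L2_norm v" using L2_norm_pos torus_H2_L2(1) v by blast
  have "torus_eq (\<lambda>x. - wderiv (wderiv v) x + (- \<mu> + \<i> * of_real s * of_real (a x)) * v x) (\<lambda>_. 0)"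
    using eq unfolding torus_eq_def T_op_def by eventually_elim (simp add: algebra_simps)
  from quadratic_eigen_identity[OF a v(1) this]
  have *: "of_real ((L2_norm (wderiv v))\<^sup>2) + - \<mu> * of_real ((L2_norm v)\<^sup>2) + \<i> * of_real s * of_real (damping a v) = 0" .
  from arg_cong[OF *, of Re] have "Re \<mu> * (L2_norm v)\<^sup>2 = (L2_norm (wderiv v))\<^sup>2"
    by (simp flip: of_real_power)
  moreover from arg_cong[OF *, of Im] have "Im \<mu> * (L2_norm v)\<^sup>2 = s * damping a v"
    by (simp flip: of_real_power)
  ultimately show "Re \<mu> = (L2_norm (wderiv v))\<^sup>2 / (L2_norm v)\<^sup>2" "Im \<mu> = s * (damping a v / (L2_norm v)\<^sup>2)"
    using N by (simp_all add: eq_divide_eq)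
qed

text \<open>Inserting both identities into the Poincare inequality and dividing by |v|^2 leaves 1
  \<le> C Im \<mu> / (s Theta) + C r^2 Re \<mu>. By smallness the last term takes at most one half,
  whence the 2 in the denominator.\<close>

lemma eigenvalue_gap:
  assumes a: "torus_Linf a" "AE x in lebesgue. 0 \<le> a x" and C: "poincare_constant C" and s: "0 < s"
    and v: "torus_H2 v" "\<not> torus_eq v (\<lambda>_. 0)" and eq: "torus_eq (T_op a s v) (\<lambda>x. \<mu> * v x)"
    and r: "0 < r" "r \<le> pi" "0 < Theta a r" and small: "2 * C * r\<^sup>2 * Re \<mu> \<le> 1"
  shows "s * Theta a r / (2 * C) \<le> Im \<mu>"
proof -
  note H1 = torus_H2_L2(6)[OF v(1)]
  define N where "N = (L2_norm v)\<^sup>2"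
  have N: "0 < N" using L2_norm_pos[OF torus_H2_L2(1) v(2)] v(1) by (simp add: N_def)
  have C0: "0 < C" by (rule poincare_constant_pos[OF C a r H1 v(2)])
  have Re: "(L2_norm (wderiv v))\<^sup>2 = Re \<mu> * N" and Im: "damping a v = Im \<mu> * N / s"
    using eigenvalue_identities[OF a(1) v eq] N s by (simp_all add: N_def)
  have "N \<le> C * (inverse (Theta a r) * (Im \<mu> * N / s) + r\<^sup>2 * (Re \<mu> * N))"
    using poincare_constantD[OF C a r H1] unfolding Re Im by (simp add: N_def)
  also have "\<dots> = (C * Im \<mu> / (s * Theta a r) + C * r\<^sup>2 * Re \<mu>) * N"
    by (simp add: field_simps)
  finally have "1 \<le> C * Im \<mu> / (s * Theta a r) + C * r\<^sup>2 * Re \<mu>"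
    using N by simp
  then have "1/2 \<le> C * Im \<mu> / (s * Theta a r)" using small by linarith
  then show ?thesis using s r C0 by (simp add: field_simps)
qed

text \<open>Young's inequality under the integral; the free \<epsilon> later decides how much of
  |g|^2 can be absorbed.\<close>

lemma norm_torus_int_mult_le:
  assumes f: "torus_L2 f" and g: "torus_L2 g" and "0 < \<epsilon>"
  shows "cmod (torus_int (\<lambda>x. f x * g x)) \<le> (L2_norm f)\<^sup>2 / (2 * \<epsilon>) + \<epsilon> / 2 * (L2_norm g)\<^sup>2"
proof -
  note i = torus_L2_mult_integrable[OF f g]
  let ?F = "\<lambda>x. 1 / (2 * \<epsilon>) * (cmod (f x))\<^sup>2" and ?G = "\<lambda>x. \<epsilon> / 2 * (cmod (g x))\<^sup>2"
  have F: "?F absolutely_integrable_on {0..2*pi}" and G: "?G absolutely_integrable_on {0..2*pi}"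
    by (intro set_integrable_mult_right torus_L2_square f g)+
  have "cmod (torus_int (\<lambda>x. f x * g x)) = cmod (integral {0..2*pi} (\<lambda>x. f x * g x))"
    by (simp only: torus_int_eq_integral[OF i])
  also have "\<dots> \<le> integral {0..2*pi} (\<lambda>x. ?F x + ?G x)"
  proof (rule Henstock_Kurzweil_Integration.integral_norm_bound_integral)
    show "(\<lambda>x. f x * g x) integrable_on {0..2*pi}" by (rule set_lebesgue_integral_eq_integral(1)[OF i])
    show "(\<lambda>x. ?F x + ?G x) integrable_on {0..2*pi}"
      by (intro integrable_add set_lebesgue_integral_eq_integral(1) F G)
    fix x
    have "0 \<le> (cmod (f x) - \<epsilon> * cmod (g x))\<^sup>2 / (2 * \<epsilon>)" using \<open>0 < \<epsilon>\<close> by simp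
    also have "\<dots> = ?F x + ?G x - cmod (f x) * cmod (g x)"
      using \<open>0 < \<epsilon>\<close> by (simp add: power2_eq_square field_simps)
    finally show "cmod (f x * g x) \<le> ?F x + ?G x" by (simp only: norm_mult)
  qed
  also have "\<dots> = torus_int (\<lambda>x. ?F x + ?G x)"
    by (rule torus_int_eq_integral[symmetric]) (intro set_integral_add F G)
  also have "\<dots> = (L2_norm f)\<^sup>2 / (2 * \<epsilon>) + \<epsilon> / 2 * (L2_norm g)\<^sup>2"
    unfolding torus_int_add[OF F G] torus_int_mult L2_norm_square by simp
  finally show ?thesis .
qed

lemma L2_norm_cnj: "L2_norm (\<lambda>x. cnj (v x)) = L2_norm v"
  by (simp add: L2_norm_def)

section \<open>A priori bound and resolvent set\<close>

lemma T_op_shift: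
  "T_op a s v x - \<mu> * v x = - wderiv (wderiv v) x + (- \<mu> + \<i> * of_real s * of_real (a x)) * v x"
  by (simp add: T_op_def algebra_simps)

lemma torus_L2_T_op_shift:
  assumes "torus_Linf a" "torus_H2 v"
  shows "torus_L2 (\<lambda>x. T_op a s v x - \<mu> * v x)"
proof -
  note L2 = torus_H2_L2[OF assms(2)]
  have "torus_L2 (\<lambda>x. - wderiv (wderiv v) x + (\<i> * of_real s) * (of_real (a x) * v x) - \<mu> * v x)"
    by (intro torus_L2_diff torus_L2_add torus_L2_uminus torus_L2_scale torus_Linf_mult_L2 assms L2)
  then show ?thesis by (simp add: T_op_def mult.assoc)
qed

text \<open>With G the pairing of (T - \<mu>) v with v, the eigenfunction identities hold up to Re G
  and Im G. The Poincare inequality becomes |v|^2 \<le> K |G| + (1 - \<delta>) |v|^2, and Young's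
  inequality splits |G|.\<close>

lemma T_op_a_priori_bound:
  assumes a: "torus_Linf a" "AE x in lebesgue. 0 \<le> a x" and C: "poincare_constant C" "0 < C" and s: "0 < s"
    and r: "0 < r" "r \<le> pi" "0 < Theta a r"
    and gap: "0 < \<delta>" "C * (inverse (Theta a r) * Im \<mu> / s + r\<^sup>2 * Re \<mu>) \<le> 1 - \<delta>"
    and v: "torus_H2 v"
  shows "L2_norm v \<le> C * (inverse (Theta a r) / s + r\<^sup>2) / \<delta> * L2_norm (\<lambda>x. T_op a s v x - \<mu> * v x)"
proof -
  define g where "g = (\<lambda>x. T_op a s v x - \<mu> * v x)"
  define G where "G = torus_int (\<lambda>x. g x * cnj (v x))"
  define N where "N = (L2_norm v)\<^sup>2"
  define \<theta> where "\<theta> = inverse (Theta a r) / s"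
  define K where "K = C * (\<theta> + r\<^sup>2)"
  have \<theta>: "0 < \<theta>" using r s by (simp add: \<theta>_def)
  have K: "0 < K" unfolding K_def using C \<theta> by (intro mult_pos_pos add_pos_nonneg) auto
  have G: "G = of_real ((L2_norm (wderiv v))\<^sup>2) + - \<mu> * of_real N + \<i> * of_real s * of_real (damping a v)"
    unfolding G_def g_def N_def T_op_shift by (rule energy_identity_potential[OF a(1) v])
  have Re: "(L2_norm (wderiv v))\<^sup>2 = Re G + Re \<mu> * N"
    and Im: "damping a v = (Im G + Im \<mu> * N) / s"
    using s by (simp_all add: G flip: of_real_power)
  have "N \<le> C * (inverse (Theta a r) * ((Im G + Im \<mu> * N) / s) + r\<^sup>2 * (Re G + Re \<mu> * N))"
    using poincare_constantD[OF C(1) a r torus_H2_L2(6)[OF v]] unfolding Re Im N_def .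
  also have "\<dots> = C * (\<theta> * Im G + r\<^sup>2 * Re G) + C * (inverse (Theta a r) * Im \<mu> / s + r\<^sup>2 * Re \<mu>) * N"
    unfolding \<theta>_def by (simp add: divide_inverse algebra_simps)
  also have "\<dots> \<le> K * cmod G + (1 - \<delta>) * N"
  proof (intro add_mono)
    have "\<theta> * Im G + r\<^sup>2 * Re G \<le> \<theta> * cmod G + r\<^sup>2 * cmod G"
      using \<theta> abs_Im_le_cmod[of G] complex_Re_le_cmod[of G] by (intro add_mono mult_left_mono) auto
    then show "C * (\<theta> * Im G + r\<^sup>2 * Re G) \<le> K * cmod G"
      unfolding K_def mult.assoc using C by (intro mult_left_mono) (auto simp: algebra_simps)
    show "C * (inverse (Theta a r) * Im \<mu> / s + r\<^sup>2 * Re \<mu>) * N \<le> (1 - \<delta>) * N"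
      by (rule mult_right_mono[OF gap(2)]) (simp add: N_def)
  qed
  finally have 1: "\<delta> * N \<le> K * cmod G" by (simp add: algebra_simps)
  \<comment> \<open>With \<epsilon> = \<delta> / K the v-part of K |G| is \<delta> / 2 * N, half of
    what the left side offers.\<close>
  have "cmod G \<le> (L2_norm g)\<^sup>2 / (2 * (\<delta> / K)) + (\<delta> / K) / 2 * N"
    using norm_torus_int_mult_le[OF _ torus_L2_cnj[OF torus_H2_L2(1)[OF v]], of g "\<delta> / K"]
      torus_L2_T_op_shift[OF a(1) v, of s \<mu>] K gap(1)
    by (simp add: G_def N_def L2_norm_cnj g_def)
  then have "K * cmod G \<le> K * ((L2_norm g)\<^sup>2 / (2 * (\<delta> / K)) + (\<delta> / K) / 2 * N)"
    using K by (intro mult_left_mono) auto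
  also have "\<dots> = K\<^sup>2 / (2 * \<delta>) * (L2_norm g)\<^sup>2 + \<delta> / 2 * N"
    using K gap(1) by (simp add: field_simps power2_eq_square)
  finally have "\<delta> / 2 * N \<le> K\<^sup>2 / (2 * \<delta>) * (L2_norm g)\<^sup>2" using 1 by linarith
  then have "(L2_norm v)\<^sup>2 \<le> (K / \<delta> * L2_norm g)\<^sup>2"
    using gap(1) by (simp add: N_def field_simps power2_eq_square)
  then have "L2_norm v \<le> K / \<delta> * L2_norm g"
    by (rule power2_le_imp_le) (use K gap(1) in simp)
  then show ?thesis by (simp add: K_def \<theta>_def g_def)
qed

text \<open>The estimate serves every clause: it bounds the inverse, it makes the kernel trivial and
  hence solutions unique, and a trivial kernel gives existence through
  \<open>Schroedinger_solvable\<close>.\<close>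

lemma resolvent_set_I:
  assumes a: "torus_Linf a"
    and bound: "\<And>v. torus_H2 v \<Longrightarrow> L2_norm v \<le> K * L2_norm (\<lambda>x. T_op a s v x - \<mu> * v x)"
  shows "\<mu> \<in> L2_resolvent_set torus_H2 (T_op a s)"
proof -
  define q where "q = (\<lambda>x. - \<mu> + \<i> * of_real s * of_real (a x))"
  have shift: "T_op a s v x - \<mu> * v x = - wderiv (wderiv v) x + q x * v x" for v x
    by (simp only: T_op_shift q_def)
  have inj: "torus_eq v (\<lambda>_. 0)"
    if v: "torus_H2 v" "torus_eq (\<lambda>x. T_op a s v x - \<mu> * v x) (\<lambda>_. 0)" for v
  proof (rule L2_norm_eq_0_imp)
    have "L2_norm (\<lambda>x. T_op a s v x - \<mu> * v x) = L2_norm (\<lambda>_. 0)"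
      using torus_L2_measurable[OF torus_L2_T_op_shift[OF a v(1)]] v(2) by (intro L2_norm_cong) auto
    also have "\<dots> = 0" by (simp add: L2_norm_def torus_int_def set_lebesgue_integral_def)
    finally show "L2_norm v = 0" using bound[OF v(1)] L2_norm_nonneg[of v] by simp
    show "torus_L2 v" by (rule torus_H2_L2(1)[OF v(1)])
  qed
  have [measurable]: "a \<in> borel_measurable lebesgue" using a by (simp add: torus_Linf_def torus_fun_def)
  have q: "torus_fun q"
    using a unfolding q_def torus_Linf_def by (auto simp: torus_fun_def)
  have qb: "AE x in lebesgue. cmod (q x) \<le> cmod \<mu> + \<bar>s\<bar> * Linf_norm a"
    using torus_Linf_bound(1)[OF a]
  proof eventually_elim
    case (elim x)
    have "cmod (q x) \<le> cmod (- \<mu>) + cmod (\<i> * of_real s * of_real (a x))"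
      unfolding q_def by (rule norm_triangle_ineq)
    also have "\<dots> = cmod \<mu> + \<bar>s\<bar> * \<bar>a x\<bar>" by (simp add: norm_mult)
    also have "\<dots> \<le> cmod \<mu> + \<bar>s\<bar> * Linf_norm a" using elim by (intro add_left_mono mult_left_mono) auto
    finally show ?case .
  qed
  have Q0: "0 \<le> cmod \<mu> + \<bar>s\<bar> * Linf_norm a" using torus_Linf_bound(2)[OF a] by simp
  have solvable: "\<exists>v. torus_H2 v \<and> torus_eq (\<lambda>x. T_op a s v x - \<mu> * v x) f" if f: "torus_L2 f" for f
    using Schroedinger_solvable[OF q qb Q0 f] inj unfolding shift by blast
  have unique: "torus_eq w v"
    if v: "torus_H2 v" "torus_eq (\<lambda>x. T_op a s v x - \<mu> * v x) f"
      and w: "torus_H2 w" "torus_eq (\<lambda>x. T_op a s w x - \<mu> * w x) f" for v w f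
  proof -
    note d = torus_H2_diff[OF w(1) v(1)]
    have "torus_eq (\<lambda>x. T_op a s (\<lambda>x. w x - v x) x - \<mu> * (w x - v x)) (\<lambda>_. 0)"
      using d(2) v(2) w(2) unfolding torus_eq_def T_op_def
      by eventually_elim (simp add: algebra_simps)
    from inj[OF d(1) this] show ?thesis unfolding torus_eq_def by simp
  qed
  show ?thesis
    unfolding L2_resolvent_set_def using solvable unique bound by blast
qed

section \<open>Critical gauges and the spectral gap\<close>

lemma critical_gauge_mono:
  assumes L: "critical_gauge S L" and "x \<le> y"
  shows "1 \<le> L x" "L x \<le> L y"
proof -
  have S: "1 \<le> S" "\<And>x. S \<le> x \<Longrightarrow> 1 \<le> L x" "\<And>x. x < S \<Longrightarrow> L x = L S"
    using L by (auto simp: critical_gauge_def)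
  obtain l where l: "mono_on {1..} l" "\<forall>x\<ge>S. L x = l (ln (exp 1 * x))"
    using L unfolding critical_gauge_def by metis
  \<comment> \<open>The constant extension in one formula; it makes L monotone on the whole
    line.\<close>
  have const: "L x = L (max S x)" for x using S(3)[of x] by (auto simp: max_def)
  show "1 \<le> L x" using S(2)[of "max S x"] const[of x] by simp
  have "l (ln (exp 1 * max S x)) \<le> l (ln (exp 1 * max S y))"
    using S(1) \<open>x \<le> y\<close> by (intro mono_onD[OF l(1)]) (auto simp: ln_mult)
  then show "L x \<le> L y" using l(2)[rule_format, of "max S x"] l(2)[rule_format, of "max S y"] const[of x] const[of y] by simp
qed

lemma spectral_gap_critical_gauge:
  assumes a: "torus_Linf a" "AE x in lebesgue. 0 \<le> a x" and C: "poincare_constant C"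
    and L: "critical_gauge S L"
    and c: "0 < c" and rm: "0 < rm" "rm \<le> pi"
    and mass: "\<And>r. 0 < r \<Longrightarrow> r \<le> rm \<Longrightarrow> c * inverse (L (1 / r)) \<le> Theta a r"
  shows "\<exists>c0>0. \<exists>s0>0. \<forall>s \<mu>. \<mu> \<in> L2_spectrum torus_H2 (T_op a s) \<and> Re \<mu> \<le> s \<and> s0 \<le> s \<longrightarrow>
    c0 * (s / L s) \<le> Im \<mu>"
proof -
  have L1: "1 \<le> L x" for x using critical_gauge_mono(1)[OF L order_refl] .
  have mass': "0 < c * inverse (L x)" for x using c L1[of x] by simp
  have C0: "0 < C"
    using poincare_constant_pos[OF C a rm(1,2) _ torus_one] mass[OF rm(1) order_refl] mass'[of "1 / rm"] by linarith
  \<comment> \<open>For s \<ge> s0 and r^2 = 1 / (4 C s): 4 C \<le> s gives (1 / r)^2 = 4 C s \<le>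
    s^2, and the last entry gives r \<le> rm.\<close>
  define s0 where "s0 = max 1 (max (4 * C) (1 / (4 * C * rm\<^sup>2)))"
  have "c / (4 * C) * (s / L s) \<le> Im \<mu>"
    if \<mu>: "\<mu> \<in> L2_spectrum torus_H2 (T_op a s)" "Re \<mu> \<le> s" "s0 \<le> s" for s \<mu>
  proof (rule ccontr)
    assume "\<not> ?thesis"
    then have Im: "Im \<mu> < c / (4 * C) * (s / L s)" by simp
    have s: "1 \<le> s" "4 * C \<le> s" "1 / (4 * C * rm\<^sup>2) \<le> s" using \<mu>(3) by (auto simp: s0_def)
    \<comment> \<open>Chosen so that Re \<mu> \<le> s yields r^2 * Re \<mu> \<le> 1 / (4 C).\<close>
    define r where "r = sqrt (1 / (4 * C * s))"
    have r2: "r\<^sup>2 = 1 / (4 * C * s)" using C0 s by (simp add: r_def)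
    have r0: "0 < r" using C0 s by (simp add: r_def)
    have "r\<^sup>2 \<le> rm\<^sup>2" unfolding r2 using s(1,3) C0 rm(1) by (simp add: field_simps)
    then have rrm: "r \<le> rm" by (rule power2_le_imp_le) (use rm in simp)
    have "(1 / r)\<^sup>2 \<le> s\<^sup>2"
      unfolding power_divide r2 using s(1,2) C0 by (simp add: power2_eq_square)
    then have "1 / r \<le> s" by (rule power2_le_imp_le) (use s in simp)
    then have "L (1 / r) \<le> L s" by (rule critical_gauge_mono(2)[OF L])
    then have "c * inverse (L s) \<le> c * inverse (L (1 / r))"
      using c L1[of "1 / r"] by (intro mult_left_mono le_imp_inverse_le) auto
    then have \<Theta>: "c * inverse (L s) \<le> Theta a r" using mass[OF r0 rrm] by linarith
    then have \<Theta>0: "0 < Theta a r" using mass'[of s] by linarith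
    \<comment> \<open>A spectral value is not yet known to have Im \<mu> \<ge> 0. For negative Im
      \<mu> the lower bound on \<open>Theta\<close> has the wrong direction, but the sign alone
      suffices.\<close>
    have "inverse (Theta a r) * Im \<mu> / s \<le> 1 / (4 * C)"
    proof (cases "0 \<le> Im \<mu>")
      case True
      have "inverse (Theta a r) \<le> L s / c"
        using le_imp_inverse_le[OF \<Theta> mass'[of s]] by (simp add: inverse_eq_divide)
      then have "inverse (Theta a r) * Im \<mu> / s \<le> L s / c * (c / (4 * C) * (s / L s)) / s"
        using True Im s L1[of s] c by (intro divide_right_mono mult_mono) auto
      also have "\<dots> = 1 / (4 * C)" using c L1[of s] s by (simp add: field_simps)
      finally show ?thesis .
    next
      case False
      then have "inverse (Theta a r) * Im \<mu> / s \<le> 0"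
        using \<Theta>0 s by (intro divide_nonpos_pos mult_nonneg_nonpos) auto
      then show ?thesis using C0 by (smt (verit) divide_pos_pos)
    qed
    moreover have "r\<^sup>2 * Re \<mu> \<le> 1 / (4 * C)"
    proof -
      have "r\<^sup>2 * Re \<mu> \<le> r\<^sup>2 * s" using \<mu>(2) by (intro mult_left_mono) auto
      then show ?thesis using s by (simp add: r2)
    qed
    ultimately have "C * (inverse (Theta a r) * Im \<mu> / s + r\<^sup>2 * Re \<mu>) \<le> C * (1 / (4 * C) + 1 / (4 * C))"
      using C0 by (intro mult_left_mono add_mono) auto
    also have "\<dots> = 1 - 1 / 2" using C0 by (simp add: field_simps)
    finally have gap: "C * (inverse (Theta a r) * Im \<mu> / s + r\<^sup>2 * Re \<mu>) \<le> 1 - 1 / 2" .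
    have "\<mu> \<in> L2_resolvent_set torus_H2 (T_op a s)"
      using s rrm rm(2) by (intro resolvent_set_I[OF a(1) T_op_a_priori_bound[OF a C C0 _ r0 _ \<Theta>0 _ gap]]) auto
    then show False using \<mu>(1) by (simp add: L2_spectrum_def)
  qed
  moreover have "0 < c / (4 * C)" "0 < s0" using c C0 by (auto simp: s0_def)
  ultimately show ?thesis by blast
qed

section \<open>Damped stationary equation\<close>

text \<open>After division by |u|^2 the identity says that z is a root of z^2 + A z + \<sigma>^2 + B
  with real A and B. Since A / 2 < \<sigma> and B \<ge> 0, the discriminant is negative, so z is not
  real and Re z = - A / 2.\<close>

lemma damped_identities:
  assumes a: "torus_Linf a" "AE x in lebesgue. 0 \<le> a x" and \<sigma>: "Linf_norm a / 2 < \<sigma>"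
    and u: "torus_H2 u" "\<not> torus_eq u (\<lambda>_. 0)"
    and eq: "torus_eq (\<lambda>x. - wderiv (wderiv u) x + ((of_real \<sigma>)\<^sup>2 + z * of_real (a x) + z\<^sup>2) * u x) (\<lambda>_. 0)"
  shows "Re z = - (1 / 2) * (damping a u / (L2_norm u)\<^sup>2)"
    and "(Im z)\<^sup>2 = \<sigma>\<^sup>2 + (L2_norm (wderiv u))\<^sup>2 / (L2_norm u)\<^sup>2 - 1 / 4 * (damping a u / (L2_norm u)\<^sup>2)\<^sup>2"
    and "- (1 / 2) * Linf_norm a \<le> Re z" "Re z \<le> 0"
proof -
  define N where "N = (L2_norm u)\<^sup>2"
  define A where "A = damping a u / N"
  define B where "B = (L2_norm (wderiv u))\<^sup>2 / N"
  have L2: "torus_L2 u" by (rule torus_H2_L2(1)[OF u(1)])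
  have N: "0 < N" using L2_norm_pos[OF L2 u(2)] by (simp add: N_def)
  have A: "0 \<le> A" "A \<le> Linf_norm a"
    using damping_bounds[OF a L2] N by (simp_all add: A_def N_def divide_le_eq)
  have B: "0 \<le> B" using N by (simp add: B_def)
  have "torus_eq (\<lambda>x. - wderiv (wderiv u) x + (((of_real \<sigma>)\<^sup>2 + z\<^sup>2) + z * of_real (a x)) * u x) (\<lambda>_. 0)"
    using eq by (simp add: algebra_simps)
  from quadratic_eigen_identity[OF a(1) u(1) this]
  have "of_real (B * N) + ((of_real \<sigma>)\<^sup>2 + z\<^sup>2) * of_real N + z * of_real (A * N) = 0"
    using N by (simp add: A_def B_def N_def)
  then have "(of_real B + ((of_real \<sigma>)\<^sup>2 + z\<^sup>2) + z * of_real A) * of_real N = 0"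
    by (simp add: algebra_simps)
  then have *: "of_real B + ((of_real \<sigma>)\<^sup>2 + z\<^sup>2) + z * of_real A = 0" using N by simp
  have re: "B + \<sigma>\<^sup>2 + ((Re z)\<^sup>2 - (Im z)\<^sup>2) + Re z * A = 0"
    using arg_cong[OF *, of Re] by (simp add: power2_eq_square flip: of_real_power)
  have im: "Im z * (2 * Re z + A) = 0"
    using arg_cong[OF *, of Im] by (simp add: power2_eq_square algebra_simps flip: of_real_power)
  have "Im z \<noteq> 0"
  proof
    assume "Im z = 0"
    \<comment> \<open>Completing the square: two nonnegative terms and a positive one cannot sum to
      0.\<close>
    then have "(Re z + A / 2)\<^sup>2 + (\<sigma>\<^sup>2 - (A / 2)\<^sup>2) + B = 0"
      using re by (simp add: power2_eq_square field_simps)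
    moreover have "(A / 2)\<^sup>2 < \<sigma>\<^sup>2" using A \<sigma> by (intro power_strict_mono) auto
    ultimately show False using B zero_le_power2[of "Re z + A / 2"] by linarith
  qed
  then have Rez: "Re z = - (1 / 2) * A" using im by simp
  then show "Re z = - (1 / 2) * (damping a u / (L2_norm u)\<^sup>2)" by (simp add: A_def N_def)
  have "(Im z)\<^sup>2 = \<sigma>\<^sup>2 + B - 1 / 4 * A\<^sup>2" using re unfolding Rez by (simp add: power2_eq_square)
  then show "(Im z)\<^sup>2 = \<sigma>\<^sup>2 + (L2_norm (wderiv u))\<^sup>2 / (L2_norm u)\<^sup>2 - 1 / 4 * (damping a u / (L2_norm u)\<^sup>2)\<^sup>2"
    by (simp add: A_def B_def N_def)
  show "- (1 / 2) * Linf_norm a \<le> Re z" "Re z \<le> 0" using Rez A by simp_all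
qed

text \<open>Chebyshev's inequality for the density |u|^2: c times the indicator of the superlevel
  set is at most a, by a \<ge> 0 outside it.\<close>

lemma superlevel_mass_le:
  assumes a: "torus_Linf a" "AE x in lebesgue. 0 \<le> a x" and u: "torus_L2 u" and c: "0 < c"
  shows "c * (LINT x:{x \<in> {0..2*pi}. c \<le> a x}|lebesgue. (cmod (u x))\<^sup>2) \<le> damping a u"
proof -
  let ?E = "{x \<in> {0..2*pi}. c \<le> a x}"
  have [measurable]: "a \<in> borel_measurable lebesgue" "{0..2*pi} \<in> sets lebesgue"
    using a by (auto simp: torus_Linf_def torus_fun_def)
  have "{x \<in> space lebesgue. x \<in> {0..2*pi} \<and> c \<le> a x} \<in> sets lebesgue" by measurable
  then have E: "?E \<in> sets lebesgue" by simp
  have iE: "set_integrable lebesgue ?E (\<lambda>x. c * (cmod (u x))\<^sup>2)"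
    by (rule set_integrable_subset[OF _ E, of "{0..2*pi}"])
      (auto intro!: set_integrable_mult_right torus_L2_square[OF u])
  have "c * (LINT x:?E|lebesgue. (cmod (u x))\<^sup>2) = (LINT x:?E|lebesgue. c * (cmod (u x))\<^sup>2)"
    by (rule set_integral_mult_right[symmetric])
  also have "\<dots> \<le> damping a u"
    unfolding damping_def torus_int_def set_lebesgue_integral_def
  proof (rule integral_mono_AE)
    show "integrable lebesgue (\<lambda>x. indicator ?E x *\<^sub>R (c * (cmod (u x))\<^sup>2))"
      using iE by (simp only: set_integrable_def)
    show "integrable lebesgue (\<lambda>x. indicator {0..2*pi} x *\<^sub>R (a x * (cmod (u x))\<^sup>2))"
      using torus_Linf_quadratic_integrable[OF a(1) u] by (simp only: set_integrable_def)
    show "AE x in lebesgue. indicator ?E x *\<^sub>R (c * (cmod (u x))\<^sup>2) \<le> indicator {0..2*pi} x *\<^sub>R (a x * (cmod (u x))\<^sup>2)"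
      using a(2) by eventually_elim (auto simp: indicator_def intro: mult_right_mono)
  qed
  finally show ?thesis .
qed

theorem proposition6p1:
  fixes a :: "real \<Rightarrow> real" and C\<^sub>P :: real
    and Y :: "'y topology" and \<A> :: "('y, 'n::finite) chart set"
    and g :: "('y, 'n) chart \<Rightarrow> real^'n \<Rightarrow> real^'n^'n" and lam :: "nat \<Rightarrow> real"
  assumes a: "torus_Linf a" "AE x in lebesgue. 0 \<le> a x"
    and C\<^sub>P: "poincare_constant C\<^sub>P"
  shows
    "(\<forall>s>0. \<forall>v \<mu>. torus_H2 v \<and> \<not> torus_eq v (\<lambda>_. 0) \<and> torus_eq (T_op a s v) (\<lambda>x. \<mu> * v x) \<longrightarrow>
        Re \<mu> = (L2_norm (wderiv v))\<^sup>2 / (L2_norm v)\<^sup>2 \<and>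
        Im \<mu> = s * (torus_int (\<lambda>x. a x * (cmod (v x))\<^sup>2) / (L2_norm v)\<^sup>2) \<and>
        (\<forall>r. 0 < r \<and> r \<le> pi \<and> Theta a r > 0 \<and> 2 * C\<^sub>P * r\<^sup>2 * Re \<mu> \<le> 1 \<longrightarrow>
           Im \<mu> \<ge> s * Theta a r / (2 * C\<^sub>P)))
     \<and>
     (\<forall>S\<^sub>0 L. critical_gauge S\<^sub>0 L \<and>
        (\<exists>c>0. \<exists>r\<^sub>m. 0 < r\<^sub>m \<and> r\<^sub>m \<le> pi \<and>
           (\<forall>r. 0 < r \<and> r \<le> r\<^sub>m \<longrightarrow> Theta a r \<ge> c * inverse (L (1 / r)))) \<longrightarrow>
        (\<exists>c\<^sub>0>0. \<exists>s\<^sub>0>0. \<forall>s \<mu>.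
           \<mu> \<in> L2_spectrum torus_H2 (T_op a s) \<and> Re \<mu> \<le> s \<and> s \<ge> s\<^sub>0 \<longrightarrow>
             Im \<mu> \<ge> c\<^sub>0 * (s / L s)))
     \<and>
     (compact_connected_riemannian_manifold Y \<A> g \<and> laplace_eigenvalues Y \<A> g lam \<longrightarrow>
        (\<forall>j u z. sqrt (lam j) > 1 / 2 * Linf_norm a \<and> torus_H2 u \<and> \<not> torus_eq u (\<lambda>_. 0) \<and>
           torus_eq (\<lambda>x. - wderiv (wderiv u) x
                         + ((of_real (sqrt (lam j)))\<^sup>2 + z * of_real (a x) + z\<^sup>2) * u x) (\<lambda>_. 0) \<longrightarrow>
           Re z = - (1 / 2) * (torus_int (\<lambda>x. a x * (cmod (u x))\<^sup>2) / (L2_norm u)\<^sup>2) \<and>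
           (Im z)\<^sup>2 = (sqrt (lam j))\<^sup>2 + (L2_norm (wderiv u))\<^sup>2 / (L2_norm u)\<^sup>2
                       - 1 / 4 * (torus_int (\<lambda>x. a x * (cmod (u x))\<^sup>2) / (L2_norm u)\<^sup>2)\<^sup>2 \<and>
           - (1 / 2) * Linf_norm a \<le> Re z \<and> Re z \<le> 0 \<and>
           (\<forall>c>0. (LINT x:{x \<in> {0..2*pi}. a x \<ge> c}|lebesgue. (cmod (u x))\<^sup>2) / (L2_norm u)\<^sup>2
                     \<le> 2 * (- Re z) / c)))"
proof (intro conjI allI impI)
  fix s :: real and v :: "real \<Rightarrow> complex" and \<mu> :: complex
  assume s: "0 < s" and v: "torus_H2 v \<and> \<not> torus_eq v (\<lambda>_. 0) \<and> torus_eq (T_op a s v) (\<lambda>x. \<mu> * v x)"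
  show "Re \<mu> = (L2_norm (wderiv v))\<^sup>2 / (L2_norm v)\<^sup>2"
    "Im \<mu> = s * (torus_int (\<lambda>x. a x * (cmod (v x))\<^sup>2) / (L2_norm v)\<^sup>2)"
    using eigenvalue_identities[OF a(1)] v by (auto simp: damping_def)
  show "s * Theta a r / (2 * C\<^sub>P) \<le> Im \<mu>"
    if "0 < r \<and> r \<le> pi \<and> 0 < Theta a r \<and> 2 * C\<^sub>P * r\<^sup>2 * Re \<mu> \<le> 1" for r
    using eigenvalue_gap[OF a C\<^sub>P s] v that by blast
next
  fix S\<^sub>0 :: real and L :: "real \<Rightarrow> real"
  assume "critical_gauge S\<^sub>0 L \<and> (\<exists>c>0. \<exists>r\<^sub>m. 0 < r\<^sub>m \<and> r\<^sub>m \<le> pi \<and>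
    (\<forall>r. 0 < r \<and> r \<le> r\<^sub>m \<longrightarrow> c * inverse (L (1 / r)) \<le> Theta a r))"
  then show "\<exists>c\<^sub>0>0. \<exists>s\<^sub>0>0. \<forall>s \<mu>. \<mu> \<in> L2_spectrum torus_H2 (T_op a s) \<and> Re \<mu> \<le> s \<and> s\<^sub>0 \<le> s \<longrightarrow>
    c\<^sub>0 * (s / L s) \<le> Im \<mu>"
    using spectral_gap_critical_gauge[OF a C\<^sub>P] by blast
next
  fix j and u :: "real \<Rightarrow> complex" and z :: complex
  assume "sqrt (lam j) > 1 / 2 * Linf_norm a \<and> torus_H2 u \<and> \<not> torus_eq u (\<lambda>_. 0) \<and>
    torus_eq (\<lambda>x. - wderiv (wderiv u) x + ((of_real (sqrt (lam j)))\<^sup>2 + z * of_real (a x) + z\<^sup>2) * u x) (\<lambda>_. 0)"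
  then have \<sigma>: "Linf_norm a / 2 < sqrt (lam j)" and u: "torus_H2 u" "\<not> torus_eq u (\<lambda>_. 0)"
    and eq: "torus_eq (\<lambda>x. - wderiv (wderiv u) x + ((of_real (sqrt (lam j)))\<^sup>2 + z * of_real (a x) + z\<^sup>2) * u x) (\<lambda>_. 0)"
    by simp_all
  note id = damped_identities[OF a \<sigma> u eq]
  show "Re z = - (1 / 2) * (torus_int (\<lambda>x. a x * (cmod (u x))\<^sup>2) / (L2_norm u)\<^sup>2)"
    "(Im z)\<^sup>2 = (sqrt (lam j))\<^sup>2 + (L2_norm (wderiv u))\<^sup>2 / (L2_norm u)\<^sup>2
       - 1 / 4 * (torus_int (\<lambda>x. a x * (cmod (u x))\<^sup>2) / (L2_norm u)\<^sup>2)\<^sup>2"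
    "- (1 / 2) * Linf_norm a \<le> Re z" "Re z \<le> 0"
    using id unfolding damping_def by blast+
  fix c :: real assume c: "0 < c"
  have L2: "torus_L2 u" by (rule torus_H2_L2(1)[OF u(1)])
  \<comment> \<open>Chebyshev's inequality; once divided by |u|^2, the formula for Re z turns the
    damping term into - 2 Re z.\<close>
  have "(LINT x:{x \<in> {0..2*pi}. c \<le> a x}|lebesgue. (cmod (u x))\<^sup>2) \<le> damping a u / c"
    using superlevel_mass_le[OF a L2 c] c by (simp add: le_divide_eq mult.commute)
  then have "(LINT x:{x \<in> {0..2*pi}. c \<le> a x}|lebesgue. (cmod (u x))\<^sup>2) / (L2_norm u)\<^sup>2 \<le> damping a u / c / (L2_norm u)\<^sup>2"
    by (rule divide_right_mono) simp
  also have "\<dots> = 2 * (- Re z) / c" unfolding id(1) by simp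
  finally show "(LINT x:{x \<in> {0..2*pi}. c \<le> a x}|lebesgue. (cmod (u x))\<^sup>2) / (L2_norm u)\<^sup>2 \<le> 2 * (- Re z) / c" .
qed

end
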